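(* Let $\beta\in C^1([0,+\infty))$ be increasing with $\beta(0)=0$ and $\beta^\infty:=\lim_{r\to+\infty}\beta(r)<+\infty$. Let $V\in C^2(\mathbb R)$ and $\lambda\in\mathbb R$ satisfy $V''\ge\lambda$ on $\mathbb R$ and $\liminf_{|x|\to+\infty}V(x)/|x|^2\ge 0$. Let $\mathfrak m>0$. A measure $\rho\in\mathscr M_2(\mathbb R,\mathfrak m)$ is a stationary Wasserstein solution of $\partial_t\rho-\partial_x(\partial_x(\beta(\rho))+V'\rho)=0$ if and only if $\rho\in\mathscr M_2^c(\mathbb R,\mathfrak m)$ and $\mathcal I(\rho)=0$.
   Context: $\mathscr M_2(\mathbb R,\mathfrak m)$ is the set of nonnegative Borel measures on $\mathbb R$ with mass $\mathfrak m$ and finite second moment, endowed with the $L^2$-Wasserstein distance; $\mathscr L^1$ is Lebesgue measure; $\rho=u\mathscr L^1+\rho^\perp$ is the Lebesgue decomposition. A finite nonnegative Borel measure $\rho$ has a generalized continuous density if its Lebesgue density has a representative $u\in C^0(\mathbb R;[0,+\infty])$ such that, with $\mathsf D(u):=\{u<+\infty\}$, $\rho^\perp(\mathsf D(u))=0$ and $\mathscr L^1(\mathbb R\setminus\mathsf D(u))=0$; $u$ then denotes this representative. $\mathscr M_+^c(\mathbb R)$ is the set of such measures, $\mathscr M_2^c(\mathbb R,\mathfrak m):=\mathscr M_+^c(\mathbb R)\cap\mathscr M_2(\mathbb R,\mathfrak m)$. $\mathsf D_+(u):=\{0<u<+\infty\}$, $\beta(+\infty):=\beta^\infty$. If $\rho\in\mathscr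 M_+^c(\mathbb R)$ and $\beta\circ u\in W^{1,1}_{\rm loc}(\mathbb R)$, $\mathcal I(\rho):=\int_{\mathsf D_+(u)}|\frac{\partial_x\beta(u)}{u}+V'|^2u\,dx+\int_{\mathbb R}|V'|^2d\rho^\perp$; otherwise $\mathcal I(\rho):=+\infty$. Wasserstein solution: $\rho\in C^0([0,+\infty);\mathscr M_2(\mathbb R,\mathfrak m))$ such that $\rho_t\in\mathscr M_+^c(\mathbb R)$ for a.e. $t>0$, $\int_{T_0}^{T_1}\mathcal I(\rho_t)\,dt<+\infty$ for all $0<T_0<T_1<+\infty$, and $\int_0^{+\infty}\int_{\mathbb R}(-\partial_t\varphi+\partial_x\varphi V')\,d\rho_t\,dt+\int_0^{+\infty}\int_{\mathbb R}\partial_x\varphi\,\partial_x\beta(u_t)\,dx\,dt=0$ for all $\varphi\in C_c^\infty((0,+\infty)\times\mathbb R)$, where $u_t$ is the generalized continuous density of $\rho_t$. A measure $\rho$ is a stationary Wasserstein solution if the constant curve $\rho_t\equiv\rho$ is a Wasserstein solution. *)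

theory Defs
  imports "HOL-Analysis.Analysis"
begin

section \<open>Regularity and weak derivatives\<close>

text \<open>
  Membership in \<open>C^k(S)\<close>. It is used for \<open>S = UNIV\<close> and for the half-line \<open>S = {0..}\<close>, where the
  derivative at the end point is the one-sided one. At points of these sets the derivative within
  \<open>S\<close> is unique.
\<close>

primrec Ck_on ::
  "nat \<Rightarrow> 'a::euclidean_space set \<Rightarrow> ('a \<Rightarrow> 'b::real_normed_vector) \<Rightarrow> bool" where
  "Ck_on 0 S f \<longleftrightarrow> continuous_on S f"
| "Ck_on (Suc k) S f \<longleftrightarrow>
     (\<forall>x\<in>S. f differentiable (at x within S)) \<and>
     (\<forall>v. Ck_on k S (\<lambda>x. frechet_derivative f (at x within S) v))"

text \<open>The space \<open>C_c^\<infinity>(\<Omega>)\<close>, its elements being extended by zero outside \<open>\<Omega>\<close>.\<close>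

definition test_functions :: "'a::euclidean_space set \<Rightarrow> ('a \<Rightarrow> real) set" where
  "test_functions \<Omega> =
     {\<phi>. (\<forall>k. Ck_on k UNIV \<phi>) \<and> compact (closure {z. \<phi> z \<noteq> 0}) \<and> closure {z. \<phi> z \<noteq> 0} \<subseteq> \<Omega>}"

definition locally_integrable :: "(real \<Rightarrow> real) \<Rightarrow> bool" where
  "locally_integrable f \<longleftrightarrow> (\<forall>K. compact K \<longrightarrow> set_integrable lborel K f)"

definition is_weak_deriv :: "(real \<Rightarrow> real) \<Rightarrow> (real \<Rightarrow> real) \<Rightarrow> bool" where
  "is_weak_deriv f g \<longleftrightarrow> locally_integrable g \<and>
     (\<forall>\<phi>\<in>test_functions UNIV.
        (\<integral>x. f x * deriv \<phi> x \<partial>lborel) = - (\<integral>x. g x * \<phi> x \<partial>lborel))"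

definition W11_loc :: "(real \<Rightarrow> real) set" where
  "W11_loc = {f. locally_integrable f \<and> (\<exists>g. is_weak_deriv f g)}"

text \<open>
  The weak derivative is determined up to Lebesgue null sets. It is only used under integrals
  with respect to Lebesgue measure, so the choice of a representative is irrelevant.
\<close>

definition weak_deriv :: "(real \<Rightarrow> real) \<Rightarrow> real \<Rightarrow> real" where
  "weak_deriv f = (SOME g. is_weak_deriv f g)"


section \<open>Measures with a generalized continuous density\<close>

text \<open>\<open>\<rho> = f \<L>\<^sup>1 + \<nu>\<close> with \<open>\<nu>\<close> singular with respect to Lebesgue measure.\<close>

definition lebesgue_decomposition ::
  "real measure \<Rightarrow> (real \<Rightarrow> ennreal) \<Rightarrow> real measure \<Rightarrow> bool" where
  "lebesgue_decomposition \<rho> f \<nu> \<longleftrightarrow>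
     f \<in> borel_measurable borel \<and> sets \<nu> = sets borel \<and>
     (\<exists>N\<in>sets borel. emeasure lborel N = 0 \<and> emeasure \<nu> (UNIV - N) = 0) \<and>
     (\<forall>A\<in>sets borel. emeasure \<rho> A = emeasure (density lborel f) A + emeasure \<nu> A)"

definition singular_part :: "real measure \<Rightarrow> real measure" where
  "singular_part \<rho> = (THE \<nu>. \<exists>f. lebesgue_decomposition \<rho> f \<nu>)"

text \<open>
  The condition that \<open>u\<close> is a representative of the Lebesgue density of \<open>\<rho>\<close> is expressed by
  \<open>u\<close> itself being the density in a Lebesgue decomposition of \<open>\<rho>\<close>.
\<close>

definition is_gen_cont_density :: "real measure \<Rightarrow> (real \<Rightarrow> ennreal) \<Rightarrow> bool" where
  "is_gen_cont_density \<rho> u \<longleftrightarrow>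
     continuous_on UNIV u \<and>
     (\<exists>\<nu>. lebesgue_decomposition \<rho> u \<nu> \<and> emeasure \<nu> {x. u x < \<infinity>} = 0) \<and>
     emeasure lborel (UNIV - {x. u x < \<infinity>}) = 0"

text \<open>Two continuous representatives agree almost everywhere, hence everywhere.\<close>

definition gen_cont_density :: "real measure \<Rightarrow> real \<Rightarrow> ennreal" where
  "gen_cont_density \<rho> = (THE u. is_gen_cont_density \<rho> u)"

definition M_plus_c :: "real measure set" where
  "M_plus_c =
     {\<rho>. sets \<rho> = sets borel \<and> finite_measure \<rho> \<and> (\<exists>u. is_gen_cont_density \<rho> u)}"

definition M2 :: "real \<Rightarrow> real measure set" where
  "M2 m =
     {\<rho>. sets \<rho> = sets borel \<and> emeasure \<rho> UNIV = ennreal m \<and>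
         (\<integral>\<^sup>+x. ennreal (x\<^sup>2) \<partial>\<rho>) < \<infinity>}"

definition M2c :: "real \<Rightarrow> real measure set" where
  "M2c m = M_plus_c \<inter> M2 m"


section \<open>The Wasserstein distance\<close>

definition couplings :: "real measure \<Rightarrow> real measure \<Rightarrow> (real \<times> real) measure set" where
  "couplings \<mu> \<nu> =
     {\<gamma>. sets \<gamma> = sets borel \<and> distr \<gamma> borel fst = \<mu> \<and> distr \<gamma> borel snd = \<nu>}"

text \<open>
  The infimum is finite whenever both measures belong to the same \<open>M2 m\<close>, so \<open>enn2real\<close> loses
  nothing there.
\<close>

definition wasserstein2 :: "real measure \<Rightarrow> real measure \<Rightarrow> real" where
  "wasserstein2 \<mu> \<nu> =
     sqrt (enn2real (INF \<gamma>\<in>couplings \<mu> \<nu>. \<integral>\<^sup>+z. ennreal ((dist (fst z) (snd z))\<^sup>2) \<partial>\<gamma>))"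

definition wasserstein_continuous_curve :: "real \<Rightarrow> (real \<Rightarrow> real measure) \<Rightarrow> bool" where
  "wasserstein_continuous_curve m \<rho> \<longleftrightarrow>
     (\<forall>t\<ge>0. \<rho> t \<in> M2 m) \<and>
     (\<forall>t\<ge>0. ((\<lambda>s. wasserstein2 (\<rho> s) (\<rho> t)) \<longlongrightarrow> 0) (at t within {0..}))"


section \<open>Wasserstein solutions\<close>

text \<open>Extension of \<open>\<beta>\<close> to \<open>[0,+\<infinity>]\<close> by its limit.\<close>

definition beta_ext :: "(real \<Rightarrow> real) \<Rightarrow> ennreal \<Rightarrow> real" where
  "beta_ext \<beta> r = (if r = \<infinity> then Lim at_top \<beta> else \<beta> (enn2real r))"

definition beta_density :: "(real \<Rightarrow> real) \<Rightarrow> real measure \<Rightarrow> real \<Rightarrow> real" where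
  "beta_density \<beta> \<rho> x = beta_ext \<beta> (gen_cont_density \<rho> x)"

definition dissipation ::
  "(real \<Rightarrow> real) \<Rightarrow> (real \<Rightarrow> real) \<Rightarrow> real measure \<Rightarrow> ennreal" where
  "dissipation \<beta> V \<rho> =
     (if \<rho> \<in> M_plus_c \<and> beta_density \<beta> \<rho> \<in> W11_loc
      then (\<integral>\<^sup>+x\<in>{x. 0 < gen_cont_density \<rho> x \<and> gen_cont_density \<rho> x < \<infinity>}.
               ennreal (\<bar>weak_deriv (beta_density \<beta> \<rho>) x / enn2real (gen_cont_density \<rho> x)
                          + deriv V x\<bar>\<^sup>2 * enn2real (gen_cont_density \<rho> x)) \<partial>lborel)
           + (\<integral>\<^sup>+x. ennreal (\<bar>deriv V x\<bar>\<^sup>2) \<partial>singular_part \<rho>)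
      else \<infinity>)"

text \<open>
  A test function \<open>\<phi>\<close> has arguments (time, space). The bound on the dissipation makes
  \<open>\<partial>\<^sub>x \<beta>(u\<^sub>t)\<close> locally integrable in space and time, so that all integrals in the weak formulation
  exist.
\<close>

definition wasserstein_solution ::
  "(real \<Rightarrow> real) \<Rightarrow> (real \<Rightarrow> real) \<Rightarrow> real \<Rightarrow> (real \<Rightarrow> real measure) \<Rightarrow> bool" where
  "wasserstein_solution \<beta> V m \<rho> \<longleftrightarrow>
     wasserstein_continuous_curve m \<rho> \<and>
     (AE t in lborel. 0 < t \<longrightarrow> \<rho> t \<in> M_plus_c) \<and>
     (\<forall>T0 T1. 0 < T0 \<and> T0 < T1 \<longrightarrow> (\<integral>\<^sup>+t\<in>{T0..T1}. dissipation \<beta> V (\<rho> t) \<partial>lborel) < \<infinity>) \<and>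
     (\<forall>\<phi>\<in>test_functions ({0<..} \<times> UNIV).
        (LINT t:{0<..}|lborel.
           (\<integral>x. - deriv (\<lambda>s. \<phi> (s, x)) t + deriv (\<lambda>y. \<phi> (t, y)) x * deriv V x \<partial>\<rho> t))
        + (LINT t:{0<..}|lborel.
           (\<integral>x. deriv (\<lambda>y. \<phi> (t, y)) x * weak_deriv (beta_density \<beta> (\<rho> t)) x \<partial>lborel))
        = 0)"

definition stationary_wasserstein_solution ::
  "(real \<Rightarrow> real) \<Rightarrow> (real \<Rightarrow> real) \<Rightarrow> real \<Rightarrow> real measure \<Rightarrow> bool" where
  "stationary_wasserstein_solution \<beta> V m \<rho> \<longleftrightarrow> wasserstein_solution \<beta> V m (\<lambda>t. \<rho>)"

end

theory Submission
  imports Defs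
begin

text \<open>
  Write \<open>u\<close> for the continuous density, \<open>\<nu>\<close> for the singular part of \<open>\<rho>\<close>, \<open>g\<close> for the weak derivative of
  \<open>\<beta>(u)\<close>, and consider the flux \<open>V' \<rho> + g \<L>\<^sup>1\<close>. The dissipation vanishes exactly when the flux does:
  on \<open>{0 < u < \<infinity>}\<close> and for \<open>\<nu>\<close> this is read off the integrands, and on \<open>{u = 0}\<close> it holds because the weak
  derivative of a continuous function vanishes almost everywhere on the zero set of that function
  (\<open>weak_deriv_zero_on_zero_set\<close>, used in \<open>dissipation_eq_0_iff\<close>).

  If the flux vanishes, the spatial terms of the weak formulation cancel at each time, and the time
  derivative of a test function integrates to zero; so the constant curve is a solution.

  Conversely, for a constant curve the weak formulation says that the flux has distributional
  derivative zero, hence is a constant multiple \<open>c \<L>\<^sup>1\<close> of Lebesgue measure (\<open>flux_constant\<close>). The singular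
  part gives \<open>V' = 0\<close> for \<open>\<nu>\<close>-almost every point, and \<open>u V' + g = c\<close> almost everywhere. The constant is zero
  (\<open>flux_zero\<close>): otherwise \<open>u\<close> is positive almost everywhere and the finite dissipation is at least the
  integral of \<open>c\<^sup>2 / u\<close>, so that \<open>u\<close> and \<open>1/u\<close> are both integrable on the real line, against
  \<open>1 \<le> u + 1/u\<close>.

  The test functions that have to be constructed are smooth approximations of indicators of half-open
  intervals, combinations of their primitives, and products of these. They are built from \<open>exp (-1/x)\<close>.
\<close>

section \<open>Smooth functions built from a flat exponential\<close>

text \<open>
  Smoothness asks for derivatives of all orders. Instead of computing them, it is enough to place the
  function in a family that contains the directional derivatives of its members; one unfolding of
  \<open>Ck_on\<close> then stays inside the family.
\<close>

lemma Ck_on_of_derivative_closed: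
  fixes S :: "('a::euclidean_space \<Rightarrow> real) set"
  assumes diff: "\<And>f x. f \<in> S \<Longrightarrow> f differentiable (at x)"
    and closed: "\<And>f v. f \<in> S \<Longrightarrow> (\<lambda>x. frechet_derivative f (at x) v) \<in> S"
    and "f \<in> S"
  shows "Ck_on k UNIV f"
  using \<open>f \<in> S\<close>
proof (induction k arbitrary: f)
  case 0
  then show ?case
    using diff by (auto intro!: continuous_at_imp_continuous_on differentiable_imp_continuous_within)
next
  case (Suc k)
  then show ?case using diff closed by auto
qed

text \<open>
  Closure under sums and products is what the Leibniz rule needs: if the derivatives of the generators
  lie in the algebra, so do the derivatives of all its elements.
\<close>

inductive_set fun_algebra :: "('a \<Rightarrow> real) set \<Rightarrow> ('a \<Rightarrow> real) set" for G where
  const: "(\<lambda>_. c) \<in> fun_algebra G"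
| gen: "f \<in> G \<Longrightarrow> f \<in> fun_algebra G"
| add: "f \<in> fun_algebra G \<Longrightarrow> g \<in> fun_algebra G \<Longrightarrow> (\<lambda>x. f x + g x) \<in> fun_algebra G"
| mult: "f \<in> fun_algebra G \<Longrightarrow> g \<in> fun_algebra G \<Longrightarrow> (\<lambda>x. f x * g x) \<in> fun_algebra G"

lemma fun_algebra_diff:
  assumes "f \<in> fun_algebra G" "g \<in> fun_algebra G"
  shows "(\<lambda>x. f x - g x) \<in> fun_algebra G"
proof -
  have "(\<lambda>x. f x + (\<lambda>_. -1) x * g x) \<in> fun_algebra G"
    by (intro fun_algebra.intros assms)
  then show ?thesis by simp
qed

lemma fun_algebra_derivative:
  fixes G :: "('a::euclidean_space \<Rightarrow> real) set"
  assumes gen: "\<And>f. f \<in> G \<Longrightarrow>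
      \<exists>D. (\<forall>x. (f has_derivative D x) (at x)) \<and> (\<forall>v. (\<lambda>x. D x v) \<in> fun_algebra G)"
    and "f \<in> fun_algebra G"
  shows "\<exists>D. (\<forall>x. (f has_derivative D x) (at x)) \<and> (\<forall>v. (\<lambda>x. D x v) \<in> fun_algebra G)"
  using assms(2)
proof induction
  case (const c)
  have "((\<lambda>_. c) has_derivative (\<lambda>_. 0)) (at x)" for x :: 'a by simp
  then show ?case
    by (intro exI[of _ "\<lambda>_ _. 0"]) (auto intro: fun_algebra.const)
next
  case (gen f)
  then show ?case using assms(1) by blast
next
  case (add f g)
  then obtain D E where
    "\<And>x. (f has_derivative D x) (at x)" "\<And>x. (g has_derivative E x) (at x)"
    "\<And>v. (\<lambda>x. D x v) \<in> fun_algebra G" "\<And>v. (\<lambda>x. E x v) \<in> fun_algebra G"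
    by blast
  then show ?case
    by (intro exI[of _ "\<lambda>x v. D x v + E x v"])
       (auto intro!: fun_algebra.add has_derivative_add)
next
  case (mult f g)
  then obtain D E where
    "\<And>x. (f has_derivative D x) (at x)" "\<And>x. (g has_derivative E x) (at x)"
    "\<And>v. (\<lambda>x. D x v) \<in> fun_algebra G" "\<And>v. (\<lambda>x. E x v) \<in> fun_algebra G"
    by blast
  with mult.hyps show ?case
    by (intro exI[of _ "\<lambda>x v. f x * E x v + D x v * g x"])
       (auto intro!: fun_algebra.add fun_algebra.mult has_derivative_mult)
qed

lemma Ck_on_fun_algebra:
  fixes G :: "('a::euclidean_space \<Rightarrow> real) set"
  assumes gen: "\<And>f. f \<in> G \<Longrightarrow>
      \<exists>D. (\<forall>x. (f has_derivative D x) (at x)) \<and> (\<forall>v. (\<lambda>x. D x v) \<in> fun_algebra G)"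
    and "f \<in> fun_algebra G"
  shows "Ck_on k UNIV f"
proof (rule Ck_on_of_derivative_closed[OF _ _ assms(2)])
  fix f assume "f \<in> fun_algebra G"
  then obtain D where D: "\<And>x. (f has_derivative D x) (at x)" "\<And>v. (\<lambda>x. D x v) \<in> fun_algebra G"
    using fun_algebra_derivative[OF gen] by blast
  show "f differentiable at x" for x using D(1) differentiableI by blast
  have "D x = frechet_derivative f (at x)" for x
    using D(1) frechet_derivative_at by blast
  then show "(\<lambda>x. frechet_derivative f (at x) v) \<in> fun_algebra G" for v
    using D(2)[of v] by simp
qed

text \<open>
  The classical function that is smooth but not analytic at the origin. The polynomial factor makes
  the family of all \<open>flat p\<close> closed under differentiation.
\<close>

definition flat :: "real poly \<Rightarrow> real \<Rightarrow> real" where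
  "flat p x = (if x > 0 then poly p (1/x) * exp (-(1/x)) else 0)"

lemma poly_times_exp_tendsto_0: "((\<lambda>y. poly p y * exp (- y)) \<longlongrightarrow> (0::real)) at_top"
proof -
  have "((\<lambda>y. \<Sum>i\<le>degree p. coeff p i * (y ^ i / exp y)) \<longlongrightarrow> (\<Sum>i\<le>degree p. coeff p i * 0)) at_top"
    by (intro tendsto_intros tendsto_power_div_exp_0)
  moreover have "(\<Sum>i\<le>degree p. coeff p i * (y ^ i / exp y)) = poly p y * exp (- y)" for y
    by (simp add: poly_altdef exp_minus sum_distrib_right divide_inverse mult.assoc)
  ultimately show ?thesis by simp
qed

text \<open>
  Away from the origin this is the product rule: with \<open>y = 1/x\<close>, differentiation sends
  \<open>p(y) exp (-y)\<close> to \<open>y\<^sup>2 (p(y) - p'(y)) exp (-y)\<close>. At the origin the difference quotient from the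
  right is \<open>y p(y) exp (-y)\<close>, and the exponential wins as \<open>y\<close> tends to infinity.
\<close>

lemma flat_has_derivative:
  "(flat p has_real_derivative flat ([:0, 0, 1:] * (p - pderiv p)) x) (at x)"
proof (cases x "0::real" rule: linorder_cases)
  case less
  have "((\<lambda>_. 0) has_real_derivative 0) (at x)" by simp
  then have "(flat p has_real_derivative 0) (at x)"
    by (rule DERIV_cong_ev[THEN iffD1, rotated -1])
       (use less in \<open>auto simp: flat_def eventually_nhds intro!: exI[of _ "{..<0}"]\<close>)
  then show ?thesis using less by (simp add: flat_def)
next
  case greater
  have "((\<lambda>x. poly p (1/x) * exp (-(1/x))) has_real_derivative
      flat ([:0, 0, 1:] * (p - pderiv p)) x) (at x)"
    using greater
    by (auto intro!: derivative_eq_intros DERIV_chain2[OF poly_DERIV]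
        simp: flat_def field_simps power2_eq_square)
  then show ?thesis
    by (rule DERIV_cong_ev[THEN iffD1, rotated -1])
       (use greater in \<open>auto simp: flat_def eventually_nhds intro!: exI[of _ "{0<..}"]\<close>)
next
  case equal
  have "((\<lambda>h. flat p h / h) \<longlongrightarrow> 0) (at_right 0)"
  proof -
    have "((\<lambda>h. poly (pCons 0 p) (inverse h) * exp (- inverse h)) \<longlongrightarrow> (0::real)) (at_right 0)"
      by (rule filterlim_compose[OF poly_times_exp_tendsto_0 filterlim_inverse_at_top_right])
    then show ?thesis
      by (rule Lim_transform_eventually)
         (auto simp: flat_def eventually_at_right_less divide_inverse mult_ac
           intro!: eventually_at_right_less[THEN eventually_mono])
  qed
  moreover have "((\<lambda>h. flat p h / h) \<longlongrightarrow> 0) (at_left 0)"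
    by (rule tendsto_eventually) (auto simp: flat_def eventually_at_filter)
  ultimately have "((\<lambda>h. flat p h / h) \<longlongrightarrow> 0) (at 0)"
    by (simp add: filterlim_at_split)
  then show ?thesis using equal by (simp add: DERIV_def flat_def)
qed

lemma continuous_flat: "continuous_on A (flat p)"
  by (intro continuous_at_imp_continuous_on ballI DERIV_isCont[OF flat_has_derivative])

lemma integral_eq_0_on: "(\<And>x. x \<in> S \<Longrightarrow> g x = 0) \<Longrightarrow> integral S g = (0::real)"
  using Henstock_Kurzweil_Integration.integral_cong[of S g "\<lambda>_. 0"] by simp

text \<open>
  Integration starts at the origin and is only used for functions vanishing on the negative half-line,
  where the interval is empty; the primitive is then differentiable everywhere.
\<close>

definition primitive :: "(real \<Rightarrow> real) \<Rightarrow> real \<Rightarrow> real" where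
  "primitive g x = integral {0..x} g"

lemma primitive_nonpos: "x \<le> 0 \<Longrightarrow> primitive g x = 0"
  by (cases "x = 0") (auto simp: primitive_def)

lemma primitive_has_derivative:
  assumes cont: "continuous_on UNIV g" and zero: "\<And>x. x \<le> 0 \<Longrightarrow> g x = 0"
  shows "(primitive g has_real_derivative g x) (at x)"
proof -
  define a where "a = min x 0 - 1"
  have eq: "primitive g y = integral {a..y} g" if "a \<le> y" for y
  proof (cases "0 \<le> y")
    case True
    have "integral {a..0} g + integral {0..y} g = integral {a..y} g"
      using True by (intro Henstock_Kurzweil_Integration.integral_combine
          integrable_continuous_interval continuous_on_subset[OF cont]) (auto simp: a_def)
    moreover have "integral {a..0} g = 0"
      by (rule integral_eq_0_on[OF zero]) simp
    ultimately show ?thesis by (simp add: primitive_def)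
  next
    case False
    then have "integral {a..y} g = 0" by (intro integral_eq_0_on zero) auto
    with False show ?thesis by (simp add: primitive_nonpos)
  qed
  have "((\<lambda>y. integral {a..y} g) has_real_derivative g x) (at x within {a..x + 1})"
    by (rule integral_has_real_derivative) (auto intro: continuous_on_subset[OF cont] simp: a_def)
  then have "((\<lambda>y. integral {a..y} g) has_real_derivative g x) (at x)"
    by (subst (asm) at_within_interior) (auto simp: a_def)
  then show ?thesis
    by (rule DERIV_cong_ev[THEN iffD1, rotated -1])
       (auto simp: eventually_nhds eq a_def intro!: exI[of _ "{min x 0 - 1<..}"])
qed

definition bump :: "real \<Rightarrow> real" where
  "bump x = flat 1 x * flat 1 (1 - x)"

text \<open>
  A smooth transition from 0 (on \<open>x \<le> 0\<close>) to 1 (on \<open>x \<ge> 1\<close>). Its support starts exactly at the origin,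
  so that rescaled steps converge pointwise everywhere, not merely almost everywhere.
\<close>

definition step :: "real \<Rightarrow> real" where
  "step x = primitive bump x / primitive bump 1"

definition ramp :: "real \<Rightarrow> real" where
  "ramp = primitive step"

lemma continuous_bump: "continuous_on A bump"
  unfolding bump_def by (intro continuous_intros continuous_flat continuous_on_compose2[OF continuous_flat]) auto

lemma bump_nonneg: "0 \<le> bump x" and bump_outside: "x \<le> 0 \<or> 1 \<le> x \<Longrightarrow> bump x = 0"
  by (auto simp: bump_def flat_def)

lemma primitive_bump_1_pos: "0 < primitive bump 1"
proof -
  have "0 \<le> primitive bump 1"
    unfolding primitive_def by (intro integral_nonneg integrable_continuous_interval continuous_bump bump_nonneg)
  moreover have "primitive bump 1 \<noteq> 0"
  proof
    assume "primitive bump 1 = 0"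
    then have "bump (1/2) = 0"
      unfolding primitive_def
      by (subst (asm) integral_eq_0_iff) (auto simp: continuous_bump bump_nonneg)
    then show False by (simp add: bump_def flat_def)
  qed
  ultimately show ?thesis by simp
qed

lemma step_has_derivative: "(step has_real_derivative bump x / primitive bump 1) (at x)"
  unfolding step_def
  by (intro DERIV_cdivide primitive_has_derivative continuous_bump bump_outside) auto

lemma continuous_step: "continuous_on A step"
  by (intro continuous_at_imp_continuous_on ballI DERIV_isCont[OF step_has_derivative])

lemma step_nonpos: "x \<le> 0 \<Longrightarrow> step x = 0"
  by (simp add: step_def primitive_nonpos)

lemma step_ge_1: assumes "1 \<le> x" shows "step x = 1"
proof -
  have "integral {0..1} bump + integral {1..x} bump = integral {0..x} bump"
    using assms by (intro Henstock_Kurzweil_Integration.integral_combine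
          integrable_continuous_interval continuous_bump) auto
  moreover have "integral {1..x} bump = 0"
    by (rule integral_eq_0_on) (auto intro: bump_outside)
  ultimately show ?thesis using primitive_bump_1_pos by (simp add: step_def primitive_def)
qed

lemma step_mono: "x \<le> y \<Longrightarrow> step x \<le> step y"
proof (rule DERIV_nonneg_imp_nondecreasing[of x y step])
  show "\<exists>d. (step has_real_derivative d) (at z) \<and> 0 \<le> d" for z
    using step_has_derivative[of z] bump_nonneg[of z] primitive_bump_1_pos
    by (intro exI[of _ "bump z / primitive bump 1"]) simp
qed

lemma step_bounds: "0 \<le> step x" "step x \<le> 1"
  using step_mono[of "min x 0" x] step_mono[of x "max x 1"] step_nonpos[of "min x 0"] step_ge_1[of "max x 1"]
  by auto

lemma ramp_has_derivative: "(ramp has_real_derivative step x) (at x)"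
  unfolding ramp_def by (intro primitive_has_derivative continuous_step step_nonpos)

lemma ramp_nonpos: "x \<le> 0 \<Longrightarrow> ramp x = 0"
  by (simp add: ramp_def primitive_nonpos)

lemma ramp_ge_1: assumes "1 \<le> x" shows "ramp x = x - 1 + ramp 1"
proof -
  have "integral {0..1} step + integral {1..x} step = integral {0..x} step"
    using assms by (intro Henstock_Kurzweil_Integration.integral_combine
          integrable_continuous_interval continuous_step) auto
  moreover have "integral {1..x} step = integral {1..x} (\<lambda>_. 1)"
    by (rule Henstock_Kurzweil_Integration.integral_cong) (auto intro: step_ge_1)
  ultimately show ?thesis using assms by (simp add: ramp_def primitive_def)
qed

text \<open>
  The linear form \<open>l\<close> makes one family serve both functions of space (\<open>l\<close> the identity) and functions of
  time and space (\<open>l\<close> one of the projections).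
\<close>

definition smooth_generators :: "('a::euclidean_space \<Rightarrow> real) set" where
  "smooth_generators =
     {\<lambda>z. F ((l z - a) / e) |F l a e. F \<in> range flat \<union> {step, ramp} \<and> bounded_linear l}"

lemma smooth_generators_derivative:
  assumes "f \<in> (smooth_generators :: ('a::euclidean_space \<Rightarrow> real) set)"
  shows "\<exists>D. (\<forall>x. (f has_derivative D x) (at x)) \<and>
             (\<forall>v. (\<lambda>x. D x v) \<in> fun_algebra smooth_generators)"
proof -
  obtain F a l e where f: "f = (\<lambda>z. F ((l z - a) / e))" and F: "F \<in> range flat \<union> {step, ramp}"
    and l: "bounded_linear l"
    using assms by (auto simp: smooth_generators_def)
  have mem: "(\<lambda>z. p ((l z - a) / e)) \<in> fun_algebra smooth_generators"
    if "p \<in> range flat \<union> {step, ramp}" for p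
    using that l by (auto simp: smooth_generators_def intro!: fun_algebra.gen)
  have "\<exists>F'. (\<forall>x. (F has_real_derivative F' x) (at x)) \<and>
      (\<lambda>z. F' ((l z - a) / e)) \<in> fun_algebra smooth_generators"
    using F
  proof (elim UnE imageE insertE emptyE; hypsubst)
    fix p show "\<exists>F'. (\<forall>x. (flat p has_real_derivative F' x) (at x)) \<and>
      (\<lambda>z. F' ((l z - a) / e)) \<in> fun_algebra smooth_generators"
      by (intro exI[of _ "flat ([:0, 0, 1:] * (p - pderiv p))"] conjI allI
          flat_has_derivative mem) simp
  next
    show "\<exists>F'. (\<forall>x. (ramp has_real_derivative F' x) (at x)) \<and>
      (\<lambda>z. F' ((l z - a) / e)) \<in> fun_algebra smooth_generators"
      by (intro exI[of _ step] conjI allI ramp_has_derivative mem) simp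
  next
    show "\<exists>F'. (\<forall>x. (step has_real_derivative F' x) (at x)) \<and>
      (\<lambda>z. F' ((l z - a) / e)) \<in> fun_algebra smooth_generators"
    proof (intro exI[of _ "\<lambda>x. bump x / primitive bump 1"] conjI allI step_has_derivative)
      have 1: "(\<lambda>z. flat 1 ((l z - a) / e)) \<in> fun_algebra smooth_generators"
        by (rule mem) simp
      show "(\<lambda>z. bump ((l z - a) / e) / primitive bump 1) \<in> fun_algebra smooth_generators"
      (* The factor flat 1 (1 - y) is again a generator: its linear form is - l. *)
      proof (cases "e = 0")
        case True
        then show ?thesis by (simp add: fun_algebra.const)
      next
        case False
        have "(\<lambda>z. flat 1 ((- l z - (- e - a)) / e)) \<in> fun_algebra smooth_generators"
          unfolding smooth_generators_def
          by (intro fun_algebra.gen CollectI exI[of _ "flat 1"] exI[of _ "\<lambda>z. - l z"]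
              exI[of _ "- e - a"] exI[of _ e] conjI refl bounded_linear_minus l) simp
        then have "(\<lambda>z. flat 1 (1 - (l z - a) / e)) \<in> fun_algebra smooth_generators"
          using False by (simp add: diff_divide_distrib add_divide_distrib algebra_simps)
        from fun_algebra.mult[OF fun_algebra.mult[OF 1 this] fun_algebra.const[of "1 / primitive bump 1"]]
        show ?thesis by (simp add: bump_def)
      qed
    qed
  qed
  then obtain F' where F': "\<And>x. (F has_real_derivative F' x) (at x)"
    "(\<lambda>z. F' ((l z - a) / e)) \<in> fun_algebra smooth_generators"
    by blast
  have "(f has_derivative (\<lambda>v. F' ((l z - a) / e) * (l v / e))) (at z)" for z
  proof -
    have "((\<lambda>z. (l z - a) / e) has_derivative (\<lambda>v. l v / e)) (at z)"
      using bounded_linear_imp_has_derivative[OF l, of "at z"]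
      by (auto intro!: derivative_eq_intros simp: divide_inverse)
    from has_derivative_compose[OF this F'(1)[THEN has_field_derivative_imp_has_derivative]]
    show ?thesis by (simp add: f)
  qed
  moreover have "(\<lambda>z. F' ((l z - a) / e) * (l v / e)) \<in> fun_algebra smooth_generators" for v
    using fun_algebra.mult[OF F'(2) fun_algebra.const] by blast
  ultimately show ?thesis
    by (intro exI[of _ "\<lambda>z v. F' ((l z - a) / e) * (l v / e)"]) auto
qed

lemma Ck_on_smooth_algebra: "f \<in> fun_algebra smooth_generators \<Longrightarrow> Ck_on k UNIV f"
  by (rule Ck_on_fun_algebra[OF smooth_generators_derivative])

section \<open>Plateau functions and their primitives\<close>

text \<open>
  A smooth approximation, as \<open>e\<close> tends to 0, of the indicator of the half-open interval from \<open>a\<close> to \<open>b\<close>.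
\<close>

definition plateau :: "real \<Rightarrow> real \<Rightarrow> real \<Rightarrow> real \<Rightarrow> real" where
  "plateau a b e x = step ((x - a) / e) - step ((x - b) / e)"

definition plateau_primitive :: "real \<Rightarrow> real \<Rightarrow> real \<Rightarrow> real \<Rightarrow> real" where
  "plateau_primitive a b e x = e * (ramp ((x - a) / e) - ramp ((x - b) / e))"

text \<open>
  Only functions of mean zero have compactly supported primitives. Every plateau of width \<open>b - a\<close> has
  integral \<open>b - a\<close>, whatever \<open>e\<close> is, so subtracting \<open>b - a\<close> times the plateau over the unit interval
  balances it; the primitive of the difference is compactly supported.
\<close>

definition balanced_primitive :: "real \<Rightarrow> real \<Rightarrow> real \<Rightarrow> real \<Rightarrow> real" where
  "balanced_primitive a b e x =
     plateau_primitive a b e x - (b - a) * plateau_primitive 0 1 e x"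

lemma test_functionI:
  fixes f :: "'a::euclidean_space \<Rightarrow> real"
  assumes "f \<in> fun_algebra smooth_generators" "compact K" "K \<subseteq> \<Omega>" "\<And>z. z \<notin> K \<Longrightarrow> f z = 0"
  shows "f \<in> test_functions \<Omega>"
proof -
  have sub: "closure {z. f z \<noteq> 0} \<subseteq> K"
    using assms(2,4) by (intro closure_minimal) (auto simp: compact_imp_closed)
  have "compact (closure {z. f z \<noteq> 0})"
    using compact_Int_closed[OF assms(2) closed_closure[of "{z. f z \<noteq> 0}"]] sub
    by (simp add: inf_absorb2)
  then show ?thesis
    using sub assms(3) Ck_on_smooth_algebra[OF assms(1)] by (auto simp: test_functions_def)
qed

lemma smooth_algebra_affine:
  assumes "F \<in> {step, ramp}" "bounded_linear l"
  shows "(\<lambda>z. F ((l z - a) / e)) \<in> fun_algebra smooth_generators"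
  using assms by (auto simp: smooth_generators_def intro!: fun_algebra.gen)

lemma plateau_smooth:
  assumes "bounded_linear l"
  shows "(\<lambda>z. plateau a b e (l z)) \<in> fun_algebra smooth_generators"
  unfolding plateau_def using assms by (intro fun_algebra_diff smooth_algebra_affine) auto

lemma plateau_primitive_smooth:
  assumes "bounded_linear l"
  shows "(\<lambda>z. plateau_primitive a b e (l z)) \<in> fun_algebra smooth_generators"
  unfolding plateau_primitive_def using assms
  by (intro fun_algebra.mult[OF fun_algebra.const] fun_algebra_diff smooth_algebra_affine) auto

lemma balanced_primitive_smooth:
  assumes "bounded_linear l"
  shows "(\<lambda>z. balanced_primitive a b e (l z)) \<in> fun_algebra smooth_generators"
  unfolding balanced_primitive_def using assms
  by (intro fun_algebra.mult[OF fun_algebra.const] fun_algebra_diff plateau_primitive_smooth)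

lemma plateau_outside:
  assumes "a \<le> b" "0 < e" "x \<notin> {a..b + e}"
  shows "plateau a b e x = 0"
  using assms by (cases "x < a") (auto simp: plateau_def step_nonpos step_ge_1 field_simps)

lemma plateau_bounds:
  assumes "a \<le> b" "0 < e"
  shows "0 \<le> plateau a b e x" "plateau a b e x \<le> 1"
proof -
  have "(x - b) / e \<le> (x - a) / e" using assms by (intro divide_right_mono) auto
  then have "step ((x - b) / e) \<le> step ((x - a) / e)" by (rule step_mono)
  then show "0 \<le> plateau a b e x" "plateau a b e x \<le> 1"
    using step_bounds(2)[of "(x - a) / e"] step_bounds(1)[of "(x - b) / e"] by (auto simp: plateau_def)
qed

lemma continuous_plateau: "continuous_on A (plateau a b e)"
  unfolding plateau_def divide_inverse
  by (intro continuous_intros continuous_on_compose2[OF continuous_step[of UNIV]]) auto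

lemma plateau_has_derivative:
  assumes "0 < e"
  shows "(plateau a b e has_real_derivative
      (bump ((x - a) / e) - bump ((x - b) / e)) / (e * primitive bump 1)) (at x)"
  unfolding plateau_def using assms primitive_bump_1_pos
  by (auto intro!: derivative_eq_intros DERIV_chain2[OF step_has_derivative] simp: field_simps)

lemma plateau_primitive_has_derivative:
  assumes "0 < e"
  shows "(plateau_primitive a b e has_real_derivative plateau a b e x) (at x)"
  unfolding plateau_primitive_def plateau_def using assms
  by (auto intro!: derivative_eq_intros DERIV_chain2[OF ramp_has_derivative] simp: field_simps)

lemma balanced_primitive_has_derivative:
  assumes "0 < e"
  shows "(balanced_primitive a b e has_real_derivative
     plateau a b e x - (b - a) * plateau 0 1 e x) (at x)"
  unfolding balanced_primitive_def using assms
  by (auto intro!: derivative_eq_intros plateau_primitive_has_derivative)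

lemma plateau_primitive_right:
  assumes "a \<le> b" "0 < e" "b + e \<le> x"
  shows "plateau_primitive a b e x = b - a"
  using assms ramp_ge_1[of "(x - a) / e"] ramp_ge_1[of "(x - b) / e"]
  by (simp add: plateau_primitive_def field_simps)

lemma balanced_primitive_outside:
  assumes "a \<le> b" "0 < e" "x \<notin> {min a 0..max b 1 + e}"
  shows "balanced_primitive a b e x = 0"
proof (cases "x < min a 0")
  case True
  then have "ramp ((x - c) / e) = 0" if "c \<in> {a, b, 0, 1}" for c
    using that assms by (intro ramp_nonpos) (auto simp: divide_nonpos_pos)
  from this[of a] this[of b] this[of 0] this[of 1] show ?thesis by (simp add: balanced_primitive_def plateau_primitive_def)
next
  case False
  then have "max b 1 + e < x" using assms(3) by auto
  then have "b + e \<le> x" "1 + e \<le> x" by auto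
  then show ?thesis using assms by (simp add: balanced_primitive_def plateau_primitive_right)
qed

text \<open>
  The convergence holds at every point, including the end points. This is essential when the plateau
  is integrated against a measure that may have atoms.
\<close>

lemma plateau_tendsto:
  assumes "a \<le> b"
  shows "(\<lambda>n. plateau a b (1 / real (Suc n)) x) \<longlonglongrightarrow> indicator {a<..b} x"
proof -
  have *: "(\<lambda>n. step ((x - c) / (1 / real (Suc n)))) \<longlonglongrightarrow> indicator {c<..} x" for c
  proof (cases "c < x")
    case True
    then obtain N where N: "1 / (x - c) < real N" using reals_Archimedean2 by blast
    have "step ((x - c) / (1 / real (Suc n))) = 1" if "N \<le> n" for n
    proof (rule step_ge_1)
      have "1 / (x - c) \<le> real (Suc n)" using N that by linarith
      then show "1 \<le> (x - c) / (1 / real (Suc n))" using True by (simp add: field_simps)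
    qed
    then have "\<forall>\<^sub>F n in sequentially. step ((x - c) / (1 / real (Suc n))) = 1"
      unfolding eventually_sequentially by blast
    then show ?thesis using True by (simp add: tendsto_eventually)
  next
    case False
    have "step ((x - c) / (1 / real (Suc n))) = 0" for n
      using False by (intro step_nonpos) (auto simp: mult_nonpos_nonneg)
    then show ?thesis using False by simp
  qed
  have "indicator {a<..} x - indicator {b<..} x = (indicator {a<..b} x :: real)"
    using assms by (auto simp: indicator_def)
  with tendsto_diff[OF *[of a] *[of b]] show ?thesis by (simp add: plateau_def)
qed

section \<open>Weak derivatives of continuous functions\<close>

lemma locally_integrable_Ioc:
  assumes "locally_integrable g" shows "set_integrable lborel {a<..b} g"
proof -
  have "set_integrable lborel {a..b} g" using assms by (simp add: locally_integrable_def)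
  then show ?thesis by (rule set_integrable_subset) auto
qed

lemma borel_measurable_of_set_integrable_Ioc:
  fixes h :: "real \<Rightarrow> real"
  assumes sets: "sets M = sets borel" and int: "\<And>a b. set_integrable M {a<..b} h"
  shows "h \<in> borel_measurable borel"
proof -
  have "h \<in> borel_measurable M"
  proof (rule borel_measurable_LIMSEQ_real)
    show "(\<lambda>x. indicator {- real n<..real n} x *\<^sub>R h x) \<in> borel_measurable M" for n
      using int[of "- real n" "real n"] by (auto simp: set_integrable_def)
    fix x
    obtain N where N: "\<bar>x\<bar> < real N" using reals_Archimedean2 by blast
    have "\<forall>\<^sub>F n in sequentially. indicator {- real n<..real n} x *\<^sub>R h x = h x"
      unfolding eventually_sequentially
    proof (intro exI[of _ N] allI impI)
      fix n assume "N \<le> n"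
      then have "x \<in> {- real n<..real n}" using N by (auto simp: abs_less_iff)
      then show "indicator {- real n<..real n} x *\<^sub>R h x = h x" by simp
    qed
    then show "(\<lambda>n. indicator {- real n<..real n} x *\<^sub>R h x) \<longlonglongrightarrow> h x" by (rule tendsto_eventually)
  qed
  then show ?thesis by (simp cong: measurable_cong_sets add: sets)
qed

lemma locally_integrable_measurable:
  "locally_integrable g \<Longrightarrow> g \<in> borel_measurable borel"
  by (rule borel_measurable_of_set_integrable_Ioc[of lborel]) (auto intro: locally_integrable_Ioc)

lemma locally_integrable_continuous_mult:
  assumes k: "continuous_on UNIV k" and g: "locally_integrable g"
  shows "locally_integrable (\<lambda>x. k x * g x)"
  unfolding locally_integrable_def
proof (intro allI impI)
  fix K :: "real set" assume K: "compact K"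
  then have [measurable]: "K \<in> sets borel" by (simp add: borel_compact)
  have [measurable]: "k \<in> borel_measurable borel" "g \<in> borel_measurable borel"
    using k g by (auto intro: borel_measurable_continuous_onI locally_integrable_measurable)
  have "compact (k ` K)" by (rule compact_continuous_image[OF continuous_on_subset[OF k] K]) simp
  then obtain B where B: "\<And>x. x \<in> K \<Longrightarrow> \<bar>k x\<bar> \<le> B"
    using compact_imp_bounded by (fastforce simp: bounded_iff)
  have "set_integrable lborel K g" using g K by (simp add: locally_integrable_def)
  then have "integrable lborel (\<lambda>x. B * (indicator K x *\<^sub>R g x))"
    by (auto simp: set_integrable_def)
  then show "set_integrable lborel K (\<lambda>x. k x * g x)"
    unfolding set_integrable_def
  proof (rule Bochner_Integration.integrable_bound)
    show "AE x in lborel. norm (indicator K x *\<^sub>R (k x * g x)) \<le> norm (B * (indicator K x *\<^sub>R g x))"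
    proof (rule AE_I2)
      fix x
      have "\<bar>k x\<bar> * \<bar>g x\<bar> \<le> \<bar>B\<bar> * \<bar>g x\<bar>" if "x \<in> K"
        using B[OF that] by (intro mult_right_mono) auto
      then show "norm (indicator K x *\<^sub>R (k x * g x)) \<le> norm (B * (indicator K x *\<^sub>R g x))"
        by (auto simp: indicator_def abs_mult)
    qed
  qed simp
qed

lemma integrable_continuous_compact_support:
  fixes h :: "real \<Rightarrow> real"
  assumes "continuous_on UNIV h" "\<And>x. x \<notin> {p..q} \<Longrightarrow> h x = 0"
  shows "integrable lborel h"
proof -
  have "set_integrable lborel {p..q} h"
    by (rule borel_integrable_atLeastAtMost') (rule continuous_on_subset[OF assms(1)], simp)
  moreover have "indicator {p..q} x *\<^sub>R h x = h x" for x
    using assms(2)[of x] by (cases "x \<in> {p..q}") auto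
  ultimately show ?thesis unfolding set_integrable_def by (simp only:)
qed

text \<open>
  Dominated convergence; it turns identities for smooth test functions into identities for half-open
  intervals, for Lebesgue measure and for the given measure alike.
\<close>

lemma plateau_integral_tendsto:
  fixes h :: "real \<Rightarrow> real"
  assumes sets: "sets M = sets borel" and int: "\<And>a b. set_integrable M {a<..b} h" and "a \<le> b"
  shows "integrable M (\<lambda>x. plateau a b (1 / real (Suc n)) x * h x)"
    and "(\<lambda>n. \<integral>x. plateau a b (1 / real (Suc n)) x * h x \<partial>M) \<longlonglongrightarrow> (LINT x:{a<..b}|M. h x)"
proof -
  note [measurable_cong] = sets
  have [measurable]: "h \<in> borel_measurable borel"
    by (rule borel_measurable_of_set_integrable_Ioc[OF sets int])
  have [measurable]: "plateau a b e \<in> borel_measurable borel" for e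
    by (intro borel_measurable_continuous_onI continuous_plateau)
  have w: "integrable M (\<lambda>x. \<bar>indicator {a - 1<..b + 1} x *\<^sub>R h x\<bar>)"
    using int[of "a - 1" "b + 1"] by (auto simp: set_integrable_def)
  have bound: "norm (plateau a b (1 / real (Suc n)) x * h x) \<le> \<bar>indicator {a - 1<..b + 1} x *\<^sub>R h x\<bar>" for n x
  proof (cases "x \<in> {a..b + 1 / real (Suc n)}")
    case True
    have "1 / real (Suc n) \<le> 1" by simp
    with True have "x \<in> {a - 1<..b + 1}" unfolding atLeastAtMost_iff greaterThanAtMost_iff by linarith
    then show ?thesis
      using plateau_bounds[OF \<open>a \<le> b\<close>, of "1 / real (Suc n)" x]
      by (auto simp: abs_mult intro!: mult_left_le_one_le)
  next
    case False
    then show ?thesis using plateau_outside[OF \<open>a \<le> b\<close>, of "1 / real (Suc n)" x] by simp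
  qed
  show "integrable M (\<lambda>x. plateau a b (1 / real (Suc n)) x * h x)"
    by (rule Bochner_Integration.integrable_bound[OF w]) (use bound in auto)
  show "(\<lambda>n. \<integral>x. plateau a b (1 / real (Suc n)) x * h x \<partial>M) \<longlonglongrightarrow> (LINT x:{a<..b}|M. h x)"
    unfolding set_lebesgue_integral_def
  proof (rule integral_dominated_convergence[OF _ _ w])
    show "AE x in M. (\<lambda>n. plateau a b (1 / real (Suc n)) x * h x) \<longlonglongrightarrow> indicator {a<..b} x *\<^sub>R h x"
      unfolding real_scaleR_def
      by (intro AE_I2 tendsto_mult tendsto_const plateau_tendsto \<open>a \<le> b\<close>)
  qed (use bound in auto)
qed

lemma bump_integral: "(\<integral>y. bump y \<partial>lborel) = primitive bump 1"
proof -
  have "(LINT y:{0..1}|lborel. bump y) = integral {0..1} bump"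
    by (intro set_borel_integral_eq_integral borel_integrable_atLeastAtMost' continuous_bump)
  moreover have "indicator {0..1} y *\<^sub>R bump y = bump y" for y
    using bump_outside[of y] by (cases "0 \<le> y \<and> y \<le> 1") auto
  ultimately show ?thesis unfolding set_lebesgue_integral_def primitive_def by (simp only:)
qed

text \<open>
  The substitution \<open>x = a + y / (n + 1)\<close> turns the integral into an average of \<open>f (a + y / (n + 1))\<close>
  with weight proportional to \<open>bump y\<close>.
\<close>

lemma bump_approximate_identity:
  fixes f :: "real \<Rightarrow> real" and a :: real
  assumes f: "continuous_on UNIV f"
  defines "k \<equiv> \<lambda>n x. bump ((x - a) / (1 / real (Suc n))) / (1 / real (Suc n) * primitive bump 1)"
  shows "integrable lborel (\<lambda>x. f x * k n x)"
    and "(\<lambda>n. \<integral>x. f x * k n x \<partial>lborel) \<longlonglongrightarrow> f a"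
proof -
  have cont_k: "continuous_on UNIV (k n)" for n
    unfolding k_def divide_inverse
    by (intro continuous_intros continuous_on_compose2[OF continuous_bump[of UNIV]]) auto
  show "integrable lborel (\<lambda>x. f x * k n x)"
  proof (rule integrable_continuous_compact_support)
    show "continuous_on UNIV (\<lambda>x. f x * k n x)" by (intro continuous_on_mult f cont_k)
    fix x assume "x \<notin> {a..a + 1}"
    have "bump ((x - a) * real (Suc n)) = 0"
    proof (rule bump_outside)
      show "(x - a) * real (Suc n) \<le> 0 \<or> 1 \<le> (x - a) * real (Suc n)"
      proof (cases "x < a")
        case False
        with \<open>x \<notin> {a..a + 1}\<close> have "1 \<le> x - a" by auto
        then have "1 * 1 \<le> (x - a) * real (Suc n)" by (intro mult_mono) auto
        then show ?thesis by simp
      qed (simp add: mult_le_0_iff)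
    qed
    then show "f x * k n x = 0" by (simp add: k_def)
  qed
  let ?c = "primitive bump 1"
  have eq: "(\<integral>x. f x * k n x \<partial>lborel) = (\<integral>y. f (a + 1 / real (Suc n) * y) * bump y / ?c \<partial>lborel)" for n
  proof -
    have "(\<integral>x. f x * k n x \<partial>lborel) =
        \<bar>1 / real (Suc n)\<bar> *\<^sub>R (\<integral>y. f (a + 1 / real (Suc n) * y) * k n (a + 1 / real (Suc n) * y) \<partial>lborel)"
      by (rule lborel_integral_real_affine) simp
    also have "\<dots> = (\<integral>y. 1 / real (Suc n) * (f (a + 1 / real (Suc n) * y) * k n (a + 1 / real (Suc n) * y)) \<partial>lborel)"
      by simp
    also have "\<dots> = (\<integral>y. f (a + 1 / real (Suc n) * y) * bump y / ?c \<partial>lborel)"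
    proof (intro Bochner_Integration.integral_cong refl)
      fix y
      define r where "r = real (Suc n)"
      have "0 < r" by (simp add: r_def)
      then have "(a + 1 / r * y - a) / (1 / r) = y" by simp
      then show "1 / real (Suc n) * (f (a + 1 / real (Suc n) * y) * k n (a + 1 / real (Suc n) * y))
          = f (a + 1 / real (Suc n) * y) * bump y / ?c"
        unfolding k_def r_def[symmetric] using \<open>0 < r\<close> by simp
    qed
    finally show ?thesis .
  qed
  have "compact (f ` {a..a + 1})"
    by (rule compact_continuous_image[OF continuous_on_subset[OF f]]) auto
  then obtain B where B: "\<And>x. x \<in> {a..a + 1} \<Longrightarrow> \<bar>f x\<bar> \<le> B"
    using compact_imp_bounded by (fastforce simp: bounded_iff)
  have [measurable]: "f \<in> borel_measurable borel" "bump \<in> borel_measurable borel"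
    using f continuous_bump by (auto intro: borel_measurable_continuous_onI)
  have "(\<lambda>n. \<integral>y. f (a + 1 / real (Suc n) * y) * bump y / ?c \<partial>lborel) \<longlonglongrightarrow> (\<integral>y. f a * bump y / ?c \<partial>lborel)"
  proof (rule integral_dominated_convergence[where w = "\<lambda>y. B * bump y / ?c"])
    show "integrable lborel (\<lambda>y. B * bump y / ?c)"
      by (intro integrable_continuous_compact_support[of _ 0 1] continuous_intros continuous_bump)
         (use primitive_bump_1_pos bump_outside in auto)
    show "AE y in lborel. (\<lambda>n. f (a + 1 / real (Suc n) * y) * bump y / ?c) \<longlonglongrightarrow> f a * bump y / ?c"
    proof (rule AE_I2)
      fix y
      have "(\<lambda>n. a + 1 / real (Suc n) * y) \<longlonglongrightarrow> a + 0 * y"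
        by (intro tendsto_intros LIMSEQ_Suc[OF lim_1_over_n])
      moreover have "isCont f a" using f by (simp add: continuous_on_eq_continuous_at)
      ultimately have "(\<lambda>n. f (a + 1 / real (Suc n) * y)) \<longlonglongrightarrow> f a"
        by (auto intro: isCont_tendsto_compose)
      then show "(\<lambda>n. f (a + 1 / real (Suc n) * y) * bump y / ?c) \<longlonglongrightarrow> f a * bump y / ?c"
        using primitive_bump_1_pos by (intro tendsto_intros) auto
    qed
    show "AE y in lborel. norm (f (a + 1 / real (Suc n) * y) * bump y / ?c) \<le> B * bump y / ?c" for n
    proof (rule AE_I2)
      fix y
      show "norm (f (a + 1 / real (Suc n) * y) * bump y / ?c) \<le> B * bump y / ?c"
      proof (cases "0 \<le> y \<and> y \<le> 1")
        case True
        then have "1 / real (Suc n) * y \<le> 1 * 1" by (intro mult_mono) auto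
        then have "\<bar>f (a + 1 / real (Suc n) * y)\<bar> \<le> B" using True by (intro B) auto
        then show ?thesis using bump_nonneg[of y] primitive_bump_1_pos
          by (auto simp: abs_mult intro!: divide_right_mono mult_right_mono)
      next
        case False
        then show ?thesis using bump_outside[of y] by auto
      qed
    qed
  qed measurable
  moreover have "(\<integral>y. f a * bump y / ?c \<partial>lborel) = f a"
    using primitive_bump_1_pos by (simp add: bump_integral)
  ultimately show "(\<lambda>n. \<integral>x. f x * k n x \<partial>lborel) \<longlonglongrightarrow> f a" by (simp only: eq)
qed

text \<open>
  Testing with a plateau: its derivative is a difference of two approximate identities, at \<open>a\<close> and at
  \<open>b\<close>, while the plateau itself converges to the indicator of the interval.
\<close>

lemma weak_deriv_increment:
  assumes f: "continuous_on UNIV f" and wd: "is_weak_deriv f g" and "a \<le> b"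
  shows "f b - f a = (LINT x:{a<..b}|lborel. g x)"
proof -
  have g: "locally_integrable g" using wd by (simp add: is_weak_deriv_def)
  let ?\<phi> = "\<lambda>n. plateau a b (1 / real (Suc n))"
  have eq: "(\<integral>x. f x * deriv (?\<phi> n) x \<partial>lborel) = - (\<integral>x. ?\<phi> n x * g x \<partial>lborel)" for n
  proof -
    have "?\<phi> n \<in> test_functions UNIV"
    proof (rule test_functionI[of _ "{a..b + 1 / real (Suc n)}"])
      show "?\<phi> n \<in> fun_algebra smooth_generators"
        using plateau_smooth[OF bounded_linear_ident] by simp
    qed (use \<open>a \<le> b\<close> in \<open>auto intro: plateau_outside\<close>)
    then show ?thesis using wd by (simp add: is_weak_deriv_def mult.commute)
  qed
  have d: "deriv (?\<phi> n) x =
      bump ((x - a) / (1 / real (Suc n))) / (1 / real (Suc n) * primitive bump 1)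
    - bump ((x - b) / (1 / real (Suc n))) / (1 / real (Suc n) * primitive bump 1)" for n x
    using DERIV_imp_deriv[OF plateau_has_derivative[of "1 / real (Suc n)" a b x]]
    by (simp only: diff_divide_distrib) simp
  have "(\<lambda>n. \<integral>x. f x * deriv (?\<phi> n) x \<partial>lborel) \<longlonglongrightarrow> f a - f b"
    unfolding d right_diff_distrib
    by (subst Bochner_Integration.integral_diff[OF bump_approximate_identity(1)[OF f] bump_approximate_identity(1)[OF f]])
       (intro tendsto_diff bump_approximate_identity(2) f)
  moreover have "(\<lambda>n. - (\<integral>x. ?\<phi> n x * g x \<partial>lborel)) \<longlonglongrightarrow> - (LINT x:{a<..b}|lborel. g x)"
    by (intro tendsto_minus plateau_integral_tendsto locally_integrable_Ioc g \<open>a \<le> b\<close>) simp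
  ultimately have "f a - f b = - (LINT x:{a<..b}|lborel. g x)"
    unfolding eq by (rule LIMSEQ_unique)
  then show ?thesis by simp
qed

lemma set_integral_Ioc_combine:
  fixes h :: "real \<Rightarrow> real"
  assumes "locally_integrable h" "p \<le> q" "q \<le> r"
  shows "(LINT x:{p<..r}|lborel. h x) = (LINT x:{p<..q}|lborel. h x) + (LINT x:{q<..r}|lborel. h x)"
proof -
  have "{p<..r} = {p<..q} \<union> {q<..r}" using assms by auto
  then show ?thesis
    by (simp only:) (intro set_integral_Un locally_integrable_Ioc assms(1); auto)
qed

lemma mean_value_closed_segment:
  fixes \<psi> \<psi>' :: "real \<Rightarrow> real"
  assumes "\<And>s. (\<psi> has_real_derivative \<psi>' s) (at s)"
  obtains s where "s \<in> closed_segment u v" "\<psi> v - \<psi> u = (v - u) * \<psi>' s"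
proof (cases u v rule: linorder_cases)
  case less
  then obtain s where "u < s" "s < v" "\<psi> v - \<psi> u = (v - u) * \<psi>' s"
    using MVT2[of u v \<psi> \<psi>'] assms by blast
  with less that[of s] show ?thesis by (auto simp: closed_segment_eq_real_ivl)
next
  case greater
  then obtain s where "v < s" "s < u" "\<psi> u - \<psi> v = (u - v) * \<psi>' s"
    using MVT2[of v u \<psi> \<psi>'] assms by blast
  with greater that[of s] show ?thesis by (auto simp: closed_segment_eq_real_ivl algebra_simps)
qed (use that[of u] in auto)

text \<open>
  The error of the formula is additive over adjacent intervals, and by the mean value theorem it is at
  most \<open>\<epsilon>\<close> times the integral of \<open>\<bar>g\<bar>\<close> on every sufficiently short interval. Bisection (Bolzano)
  propagates this bound to the whole interval.
\<close>

lemma chain_rule_increment: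
  assumes f: "continuous_on UNIV f" and g: "locally_integrable g"
    and inc: "\<And>p q. p \<le> q \<Longrightarrow> f q - f p = (LINT x:{p<..q}|lborel. g x)"
    and der: "\<And>s. (\<psi> has_real_derivative \<psi>' s) (at s)" and cont: "continuous_on UNIV \<psi>'"
    and "a \<le> b"
  shows "\<psi> (f b) - \<psi> (f a) = (LINT x:{a<..b}|lborel. \<psi>' (f x) * g x)"
proof -
  have cont_f: "continuous_on UNIV (\<lambda>x. \<psi>' (f x))"
    by (rule continuous_on_compose2[OF cont f]) simp
  have h: "locally_integrable (\<lambda>x. \<psi>' (f x) * g x)"
    by (rule locally_integrable_continuous_mult[OF cont_f g])
  have abs_g: "locally_integrable (\<lambda>x. \<bar>g x\<bar>)"
    using g by (auto simp: locally_integrable_def intro: set_integrable_abs)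
  define \<Delta> where "\<Delta> p q = \<psi> (f q) - \<psi> (f p) - (LINT x:{p<..q}|lborel. \<psi>' (f x) * g x)" for p q
  have approx: "\<bar>\<Delta> a b\<bar> \<le> \<epsilon> * (LINT x:{a<..b}|lborel. \<bar>g x\<bar>)" if "0 < \<epsilon>" for \<epsilon>
    using \<open>a \<le> b\<close>
  proof (induction rule: Bolzano)
    case (trans p q r)
    have "\<Delta> p r = \<Delta> p q + \<Delta> q r"
      using set_integral_Ioc_combine[OF h trans(3,4)] by (simp add: \<Delta>_def)
    moreover have "(LINT x:{p<..r}|lborel. \<bar>g x\<bar>)
        = (LINT x:{p<..q}|lborel. \<bar>g x\<bar>) + (LINT x:{q<..r}|lborel. \<bar>g x\<bar>)"
      by (rule set_integral_Ioc_combine[OF abs_g trans(3,4)])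
    ultimately show ?case using trans(1,2) by (simp add: distrib_left)
  next
    case (local x)
    have "isCont \<psi>' (f x)" using cont by (simp add: continuous_on_eq_continuous_at)
    then obtain \<eta> where \<eta>: "0 < \<eta>" "\<And>s. \<bar>s - f x\<bar> < \<eta> \<Longrightarrow> \<bar>\<psi>' s - \<psi>' (f x)\<bar> < \<epsilon> / 2"
      using \<open>0 < \<epsilon>\<close> by (auto simp: continuous_at_eps_delta dist_real_def dest!: spec[where x = "\<epsilon> / 2" and P = "\<lambda>e. 0 < e \<longrightarrow> _ e"])
    have "isCont f x" using f by (simp add: continuous_on_eq_continuous_at)
    then obtain d where d: "0 < d" "\<And>z. \<bar>z - x\<bar> < d \<Longrightarrow> \<bar>f z - f x\<bar> < \<eta>"
      using \<eta>(1) by (auto simp: continuous_at_eps_delta dist_real_def)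
    show ?case
    proof (intro exI[of _ d] conjI allI impI d(1))
      fix p q assume pq: "p \<le> x \<and> x \<le> q \<and> q - p < d"
      obtain s where s: "s \<in> closed_segment (f p) (f q)" "\<psi> (f q) - \<psi> (f p) = (f q - f p) * \<psi>' s"
        using mean_value_closed_segment[OF der] by blast
      have "closed_segment (f p) (f q) \<subseteq> ball (f x) \<eta>"
        using pq d(2)[of p] d(2)[of q]
        by (intro closed_segment_subset) (auto simp: dist_real_def abs_minus_commute)
      then have s': "\<bar>\<psi>' s - \<psi>' (f x)\<bar> < \<epsilon> / 2"
        using s(1) by (intro \<eta>(2)) (auto simp: dist_real_def abs_minus_commute)
      have "(LINT z:{p<..q}|lborel. \<psi>' s * g z) = \<psi>' s * (LINT z:{p<..q}|lborel. g z)"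
        by simp
      then have "\<Delta> p q = (LINT z:{p<..q}|lborel. \<psi>' s * g z) - (LINT z:{p<..q}|lborel. \<psi>' (f z) * g z)"
        using s(2) inc[of p q] pq by (simp add: \<Delta>_def)
      also have "\<dots> = (LINT z:{p<..q}|lborel. \<psi>' s * g z - \<psi>' (f z) * g z)"
        by (intro set_integral_diff(2)[symmetric] locally_integrable_Ioc h set_integrable_mult_right g)
      finally have "\<bar>\<Delta> p q\<bar> \<le> (LINT z:{p<..q}|lborel. \<bar>\<psi>' s * g z - \<psi>' (f z) * g z\<bar>)"
        unfolding set_lebesgue_integral_def
        using integral_abs_bound[of lborel "\<lambda>z. indicator {p<..q} z *\<^sub>R (\<psi>' s * g z - \<psi>' (f z) * g z)"]
        by (simp add: abs_mult)
      also have "\<dots> \<le> (LINT z:{p<..q}|lborel. \<epsilon> * \<bar>g z\<bar>)"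
      proof (rule set_integral_mono)
        fix z assume "z \<in> {p<..q}"
        then have "\<bar>f z - f x\<bar> < \<eta>" using pq by (intro d(2)) auto
        then have "\<bar>\<psi>' s - \<psi>' (f z)\<bar> \<le> \<epsilon>" using s' \<eta>(2)[of "f z"] by (auto simp: abs_if split: if_splits)
        then show "\<bar>\<psi>' s * g z - \<psi>' (f z) * g z\<bar> \<le> \<epsilon> * \<bar>g z\<bar>"
          by (simp add: left_diff_distrib[symmetric] abs_mult mult_right_mono)
      next
        have "set_integrable lborel {p<..q} (\<lambda>z. \<psi>' s * g z - \<psi>' (f z) * g z)"
          by (intro set_integral_diff(1) set_integrable_mult_right locally_integrable_Ioc h g)
        then show "set_integrable lborel {p<..q} (\<lambda>z. \<bar>\<psi>' s * g z - \<psi>' (f z) * g z\<bar>)"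
          by (rule set_integrable_abs)
        show "set_integrable lborel {p<..q} (\<lambda>z. \<epsilon> * \<bar>g z\<bar>)"
          by (intro set_integrable_mult_right locally_integrable_Ioc abs_g)
      qed
      finally show "\<bar>\<Delta> p q\<bar> \<le> \<epsilon> * (LINT x:{p<..q}|lborel. \<bar>g x\<bar>)" by simp
    qed
  qed
  have "\<bar>\<Delta> a b\<bar> \<le> 0"
  proof (rule field_le_epsilon)
    fix e :: real assume "0 < e"
    \<comment> \<open>Adding 1 avoids a division by zero when \<open>g\<close> vanishes on the interval.\<close>
    define I where "I = (LINT x:{a<..b}|lborel. \<bar>g x\<bar>)"
    have "0 \<le> I" unfolding I_def set_lebesgue_integral_def by (intro Bochner_Integration.integral_nonneg) auto
    have "\<bar>\<Delta> a b\<bar> \<le> e / (I + 1) * I"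
      unfolding I_def by (rule approx) (use \<open>0 < e\<close> \<open>0 \<le> I\<close> in \<open>auto simp: I_def\<close>)
    also have "\<dots> \<le> e" using \<open>0 < e\<close> \<open>0 \<le> I\<close> by (simp add: field_simps)
    finally show "\<bar>\<Delta> a b\<bar> \<le> 0 + e" by simp
  qed
  then show ?thesis by (simp add: \<Delta>_def)
qed

section \<open>Integrals over half-open intervals determine integrals over Borel sets\<close>

text \<open>
  Both sides are signed, so uniqueness of measures does not apply directly; Dynkin's argument is
  repeated for the two set functions inside one bounded window \<open>{p<..q}\<close>, which makes everything
  integrable.
\<close>

lemma set_integral_eq_of_Ioc:
  fixes h1 h2 :: "real \<Rightarrow> real"
  assumes sets: "sets \<mu> = sets borel" "sets \<nu> = sets borel"
    and int: "\<And>a b. set_integrable \<mu> {a<..b} h1" "\<And>a b. set_integrable \<nu> {a<..b} h2"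
    and eq: "\<And>a b. a < b \<Longrightarrow> (LINT x:{a<..b}|\<mu>. h1 x) = (LINT x:{a<..b}|\<nu>. h2 x)"
    and A: "A \<in> sets borel" "A \<subseteq> {p<..q}"
  shows "(LINT x:A|\<mu>. h1 x) = (LINT x:A|\<nu>. h2 x)"
proof -
  let ?G = "range (\<lambda>(a, b). {a<..b::real})" and ?W = "{p<..q}"
  have eq': "(LINT x:{a<..b}|\<mu>. h1 x) = (LINT x:{a<..b}|\<nu>. h2 x)" for a b
    using eq[of a b] by (cases "a < b") (auto simp: set_lebesgue_integral_def)
  have borel: "sets borel = sigma_sets UNIV ?G"
    by (subst borel_sigma_sets_Ioc) simp
  have sub: "set_integrable \<mu> B h1" "set_integrable \<nu> B h2" if "B \<in> sets borel" "B \<subseteq> ?W" for B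
    using that int[of p q] by (auto intro: set_integrable_subset simp: sets)
  have closed: "?G \<subseteq> Pow UNIV" by simp
  have gen: "A \<in> sigma_sets UNIV ?G" using A borel by simp
  have stable: "Int_stable ?G"
  proof (rule Int_stableI_image)
    fix i j :: "real \<times> real"
    have "{fst i<..snd i} \<inter> {fst j<..snd j} = {max (fst i) (fst j)<..min (snd i) (snd j)}" by auto
    then show "\<exists>k\<in>UNIV. (case i of (a, b) \<Rightarrow> {a<..b}) \<inter> (case j of (a, b) \<Rightarrow> {a<..b}) = (case k of (a, b) \<Rightarrow> {a<..b})"
      by (intro bexI[of _ "(max (fst i) (fst j), min (snd i) (snd j))"]) (auto simp: case_prod_beta)
  qed
  have "(LINT x:A \<inter> ?W|\<mu>. h1 x) = (LINT x:A \<inter> ?W|\<nu>. h2 x)"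
    using stable closed gen
  proof (induction A rule: sigma_sets_induct_disjoint)
    case (basic B)
    then obtain a b where "B = {a<..b}" by auto
    then have "B \<inter> ?W = {max a p<..min b q}" by auto
    then show ?case using eq' by simp
  next
    case empty
    then show ?case by (simp add: set_lebesgue_integral_def)
  next
    case (compl B)
    then have [measurable]: "B \<in> sets borel" by (simp add: borel)
    have "(LINT x:(B \<inter> ?W) \<union> ((UNIV - B) \<inter> ?W)|\<mu>. h1 x)
        = (LINT x:B \<inter> ?W|\<mu>. h1 x) + (LINT x:(UNIV - B) \<inter> ?W|\<mu>. h1 x)"
      by (intro set_integral_Un sub) auto
    moreover have "(LINT x:(B \<inter> ?W) \<union> ((UNIV - B) \<inter> ?W)|\<nu>. h2 x)
        = (LINT x:B \<inter> ?W|\<nu>. h2 x) + (LINT x:(UNIV - B) \<inter> ?W|\<nu>. h2 x)"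
      by (intro set_integral_Un sub) auto
    moreover have "(B \<inter> ?W) \<union> ((UNIV - B) \<inter> ?W) = ?W" by auto
    ultimately show ?case using compl.IH eq'[of p q] by simp
  next
    case (union B)
    then have B: "B i \<in> sets borel" for i by (auto simp: borel)
    have disj: "B i \<inter> ?W \<inter> (B j \<inter> ?W) = {}" if "i \<noteq> j" for i j
      using union.hyps(1) that by (auto simp: disjoint_family_on_def)
    have W: "(\<Union>i. B i) \<inter> ?W = (\<Union>i. B i \<inter> ?W)" by auto
    have 1: "(LINT x:(\<Union>i. B i \<inter> ?W)|\<mu>. h1 x) = (\<Sum>i. LINT x:B i \<inter> ?W|\<mu>. h1 x)"
      using B disj by (intro lebesgue_integral_countable_add sub) (auto simp: sets intro!: sets.countable_UN)
    have 2: "(LINT x:(\<Union>i. B i \<inter> ?W)|\<nu>. h2 x) = (\<Sum>i. LINT x:B i \<inter> ?W|\<nu>. h2 x)"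
      using B disj by (intro lebesgue_integral_countable_add sub) (auto simp: sets intro!: sets.countable_UN)
    show ?case unfolding W 1 2 using union.IH by simp
  qed
  moreover have "A \<inter> ?W = A" using A by auto
  ultimately show ?thesis by simp
qed

lemma AE_zero_of_set_integrals:
  fixes h :: "real \<Rightarrow> real"
  assumes "sigma_finite_measure M"
    and sets: "sets M = sets borel" and int: "\<And>a b. set_integrable M {a<..b} h"
    and zero: "\<And>A p q. A \<in> sets borel \<Longrightarrow> A \<subseteq> {p<..q} \<Longrightarrow> (LINT x:A|M. h x) = 0"
  shows "AE x in M. h x = 0"
proof -
  have "AE x in M. indicator {- real n<..real n} x *\<^sub>R h x = 0" for n
  proof (rule sigma_finite_measure.density_zero[OF assms(1)])
    show "integrable M (\<lambda>x. indicator {- real n<..real n} x *\<^sub>R h x)"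
      using int by (simp add: set_integrable_def)
    fix A assume "A \<in> sets M"
    then have "(LINT x:A \<inter> {- real n<..real n}|M. h x) = 0"
      by (intro zero[of _ "- real n" "real n"]) (auto simp: sets)
    then show "(LINT x:A|M. indicator {- real n<..real n} x *\<^sub>R h x) = 0"
      by (simp add: set_lebesgue_integral_def indicator_inter_arith mult.assoc)
  qed
  then have "AE x in M. \<forall>n. indicator {- real n<..real n} x *\<^sub>R h x = 0"
    by (simp only: AE_all_countable simp_thms)
  then show ?thesis
  proof (rule AE_mp, intro AE_I2 impI)
    fix x assume *: "\<forall>n. indicator {- real n<..real n} x *\<^sub>R h x = 0"
    obtain n where "\<bar>x\<bar> < real n" using reals_Archimedean2 by blast
    then have "x \<in> {- real n<..real n}" by (auto simp: abs_less_iff)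
    with * show "h x = 0" by (metis indicator_simps(1) scaleR_one)
  qed
qed

section \<open>The weak derivative on the zero set\<close>

text \<open>
  Apply the chain rule to \<open>\<psi>\<^sub>n(s) = arctan (n s) / n\<close>. These functions tend to 0 uniformly, whereas
  their derivatives \<open>1 / (1 + (n s)\<^sup>2)\<close> are bounded by 1 and converge to the indicator of \<open>{0}\<close>. In the
  limit, the integral of \<open>g\<close> over \<open>{f = 0}\<close> intersected with any interval vanishes.
\<close>

lemma weak_deriv_zero_on_zero_set:
  assumes f: "continuous_on UNIV f" and wd: "is_weak_deriv f g"
  shows "AE x in lborel. f x = 0 \<longrightarrow> g x = 0"
proof -
  have g: "locally_integrable g" using wd by (simp add: is_weak_deriv_def)
  have [measurable]: "f \<in> borel_measurable borel" "g \<in> borel_measurable borel"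
    using f g by (auto intro: borel_measurable_continuous_onI locally_integrable_measurable)
  let ?h = "\<lambda>x. indicator {x. f x = 0} x * g x"
  have h: "set_integrable lborel {a<..b} ?h" for a b
  proof -
    have "set_integrable lborel ({a<..b} \<inter> {x. f x = 0}) g"
      by (rule set_integrable_subset[OF locally_integrable_Ioc[OF g, of a b]]) auto
    then show ?thesis by (simp add: set_integrable_def indicator_inter_arith mult.assoc)
  qed
  have "(LINT x:{a<..b}|lborel. ?h x) = 0" if "a < b" for a b
  proof -
    define \<psi> where "\<psi> n s = arctan (real (Suc n) * s) / real (Suc n)" for n s
    define \<psi>' where "\<psi>' n s = 1 / (1 + (real (Suc n) * s)\<^sup>2)" for n s
    have pos: "0 < 1 + (real (Suc n) * s)\<^sup>2" for n s by (simp add: add_pos_nonneg)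
    have "(\<psi> n has_real_derivative \<psi>' n s) (at s)" for n s
    proof -
      define r where "r = real (Suc n)"
      have "0 < r" by (simp add: r_def)
      have "((\<lambda>s. arctan (r * s)) has_real_derivative inverse (1 + (r * s)\<^sup>2) * r) (at s)"
        by (rule DERIV_chain2[OF DERIV_arctan]) (auto intro!: derivative_eq_intros)
      from DERIV_cdivide[OF this, of r] \<open>0 < r\<close> show ?thesis
        by (simp add: \<psi>_def[abs_def] \<psi>'_def r_def[symmetric] inverse_eq_divide del: of_nat_Suc)
    qed
    moreover have "continuous_on UNIV (\<psi>' n)" for n
      unfolding \<psi>'_def by (intro continuous_intros) (metis pos less_irrefl)
    ultimately have eq: "\<psi> n (f b) - \<psi> n (f a) = (LINT x:{a<..b}|lborel. \<psi>' n (f x) * g x)" for n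
      using chain_rule_increment[OF f g weak_deriv_increment[OF f wd]] \<open>a < b\<close> by simp
    have "(\<lambda>n. \<psi> n (f b) - \<psi> n (f a)) \<longlonglongrightarrow> 0 - 0"
    proof (rule tendsto_diff)
      have "(\<lambda>n. \<psi> n s) \<longlonglongrightarrow> 0" for s
      proof (rule Lim_null_comparison)
        show "(\<lambda>n. 2 * (1 / real (Suc n))) \<longlonglongrightarrow> 0"
          using tendsto_mult[OF tendsto_const[of 2] LIMSEQ_Suc[OF lim_1_over_n]] by simp
        have "\<bar>arctan t\<bar> \<le> 2" for t
          using arctan_bounded[of t] pi_less_4 by (auto simp: abs_le_iff)
        then show "\<forall>\<^sub>F n in sequentially. norm (\<psi> n s) \<le> 2 * (1 / real (Suc n))"
          by (intro always_eventually allI) (simp add: \<psi>_def divide_right_mono)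
      qed
      then show "(\<lambda>n. \<psi> n (f b)) \<longlonglongrightarrow> 0" "(\<lambda>n. \<psi> n (f a)) \<longlonglongrightarrow> 0" by auto
    qed
    moreover have "(\<lambda>n. LINT x:{a<..b}|lborel. \<psi>' n (f x) * g x) \<longlonglongrightarrow> (LINT x:{a<..b}|lborel. ?h x)"
      unfolding set_lebesgue_integral_def
    proof (rule integral_dominated_convergence[where w = "\<lambda>x. \<bar>indicator {a<..b} x *\<^sub>R g x\<bar>"])
      show "integrable lborel (\<lambda>x. \<bar>indicator {a<..b} x *\<^sub>R g x\<bar>)"
        using locally_integrable_Ioc[OF g, of a b] by (auto simp: set_integrable_def)
      show "AE x in lborel. (\<lambda>n. indicator {a<..b} x *\<^sub>R (\<psi>' n (f x) * g x)) \<longlonglongrightarrow> indicator {a<..b} x *\<^sub>R ?h x"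
      proof (intro AE_I2 tendsto_intros)
        fix x
        show "(\<lambda>n. \<psi>' n (f x)) \<longlonglongrightarrow> indicator {x. f x = 0} x"
        proof (cases "f x = 0")
          case False
          have "(\<lambda>n. (1 / real (Suc n)) * (1 / \<bar>f x\<bar>)) \<longlonglongrightarrow> 0 * (1 / \<bar>f x\<bar>)"
            by (intro tendsto_intros LIMSEQ_Suc[OF lim_1_over_n])
          then have lim: "(\<lambda>n. (1 / real (Suc n)) * (1 / \<bar>f x\<bar>)) \<longlonglongrightarrow> 0" by simp
          have "(\<lambda>n. \<psi>' n (f x)) \<longlonglongrightarrow> 0"
          proof (rule Lim_null_comparison[OF always_eventually[OF allI] lim])
            fix n
            define t where "t = real (Suc n) * \<bar>f x\<bar>"
            have "0 < t" using False by (simp add: t_def)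
            have "0 \<le> (t - 1)\<^sup>2" by simp
            then have "t \<le> 1 + t\<^sup>2" using \<open>0 < t\<close> by (simp add: power2_eq_square algebra_simps)
            then have "1 / (1 + t\<^sup>2) \<le> 1 / t" using \<open>0 < t\<close> by (intro divide_left_mono) (auto simp: add_pos_nonneg)
            then show "norm (\<psi>' n (f x)) \<le> (1 / real (Suc n)) * (1 / \<bar>f x\<bar>)"
              using pos[of n "f x"] by (simp add: \<psi>'_def t_def power_mult_distrib del: of_nat_Suc)
          qed
          with False show ?thesis by simp
        qed (simp add: \<psi>'_def)
      qed
      show "AE x in lborel. norm (indicator {a<..b} x *\<^sub>R (\<psi>' n (f x) * g x)) \<le> \<bar>indicator {a<..b} x *\<^sub>R g x\<bar>" for n
      proof (rule AE_I2)
        fix x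
        have "0 \<le> \<psi>' n (f x)" "\<psi>' n (f x) \<le> 1" using pos[of n "f x"] by (auto simp: \<psi>'_def)
        then show "norm (indicator {a<..b} x *\<^sub>R (\<psi>' n (f x) * g x)) \<le> \<bar>indicator {a<..b} x *\<^sub>R g x\<bar>"
          by (auto simp: abs_mult indicator_def intro: mult_left_le_one_le)
      qed
    qed (auto simp: \<psi>'_def simp del: of_nat_Suc)
    ultimately show ?thesis unfolding eq by (auto dest: LIMSEQ_unique)
  qed
  then have Ioc: "(LINT x:{a<..b}|lborel. ?h x) = (LINT x:{a<..b}|lborel. 0)" if "a < b" for a b
    using that by (simp add: set_lebesgue_integral_def)
  have zero: "set_integrable lborel {a<..b} (\<lambda>_. 0 :: real)" for a b :: real
    by (simp add: set_integrable_def)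
  have "AE x in lborel. ?h x = 0"
  proof (rule AE_zero_of_set_integrals[OF sigma_finite_lborel _ h])
    fix A p q assume "A \<in> sets borel" "A \<subseteq> {p<..q::real}"
    from set_integral_eq_of_Ioc[OF sets_lborel sets_lborel h zero Ioc this] show "(LINT x:A|lborel. ?h x) = 0" by (simp add: set_lebesgue_integral_def)
  qed simp
  then show ?thesis by (rule AE_mp) (auto simp: indicator_def)
qed

section \<open>The Lebesgue decomposition and the generalized continuous density\<close>

lemma lebesgue_decomposition_finite:
  assumes "finite_measure \<rho>" "lebesgue_decomposition \<rho> f \<nu>"
  shows "(\<integral>\<^sup>+x. f x \<partial>lborel) \<noteq> \<infinity>"
proof -
  have [measurable]: "f \<in> borel_measurable borel"
    and eq: "emeasure \<rho> UNIV = emeasure (density lborel f) UNIV + emeasure \<nu> UNIV"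
    using assms(2) by (auto simp: lebesgue_decomposition_def)
  have "emeasure \<rho> UNIV \<noteq> \<infinity>"
    using finite_measure.emeasure_finite[OF assms(1), of UNIV] by simp
  then show ?thesis using eq by (auto simp: emeasure_density)
qed

lemma emeasure_density_lborel_null:
  assumes "f \<in> borel_measurable borel" "N \<in> sets borel" "emeasure lborel N = 0" "A \<in> sets borel" "A \<subseteq> N"
  shows "emeasure (density lborel f) A = 0"
proof -
  have "N \<in> null_sets lborel" using assms by (auto simp: null_sets_def)
  then have "A \<in> null_sets lborel" using assms by (auto intro: null_sets_subset)
  then have "A \<in> null_sets (density lborel f)"
    using assms(1,4) by (auto simp: null_sets_density_iff intro: AE_not_in AE_mp)
  then show ?thesis by (simp add: null_sets_def)
qed

lemma emeasure_concentrated: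
  assumes "sets \<nu> = sets borel" "N \<in> sets borel" "emeasure \<nu> (UNIV - N) = 0" "A \<in> sets borel" "N \<subseteq> B" "B \<in> sets borel"
  shows "emeasure \<nu> A = emeasure \<nu> (A \<inter> B)"
proof -
  have "UNIV - N \<in> null_sets \<nu>" using assms by (auto simp: null_sets_def)
  then have "A - B \<in> null_sets \<nu>"
    by (rule null_sets_subset) (use assms in auto)
  moreover have "A = (A \<inter> B) \<union> (A - B)" by auto
  ultimately show ?thesis
    using emeasure_Un_null_set[of "A \<inter> B" \<nu> "A - B"] assms by auto
qed

text \<open>
  On the union of the two null sets carrying the singular parts, the measure \<open>\<rho>\<close> coincides with either
  singular part, so these agree; subtracting them leaves the absolutely continuous parts.
\<close>

lemma lebesgue_decomposition_unique:
  assumes fin: "finite_measure \<rho>"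
    and d1: "lebesgue_decomposition \<rho> f \<nu>" and d2: "lebesgue_decomposition \<rho> f' \<nu>'"
  shows "\<nu> = \<nu>'" and "AE x in lborel. f x = f' x"
proof -
  obtain N where N: "N \<in> sets borel" "emeasure lborel N = 0" "emeasure \<nu> (UNIV - N) = 0"
    using d1 by (auto simp: lebesgue_decomposition_def)
  obtain N' where N': "N' \<in> sets borel" "emeasure lborel N' = 0" "emeasure \<nu>' (UNIV - N') = 0"
    using d2 by (auto simp: lebesgue_decomposition_def)
  have [measurable]: "f \<in> borel_measurable borel" "f' \<in> borel_measurable borel"
    and sets: "sets \<nu> = sets borel" "sets \<nu>' = sets borel"
    and eq1: "\<And>A. A \<in> sets borel \<Longrightarrow> emeasure \<rho> A = emeasure (density lborel f) A + emeasure \<nu> A"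
    and eq2: "\<And>A. A \<in> sets borel \<Longrightarrow> emeasure \<rho> A = emeasure (density lborel f') A + emeasure \<nu>' A"
    using d1 d2 by (auto simp: lebesgue_decomposition_def)
  define B where "B = N \<union> N'"
  have B: "B \<in> sets borel" "emeasure lborel B = 0"
    using N N' by (auto simp: B_def intro!: emeasure_Un_null_set[THEN trans] simp: null_sets_def)
  have on_B: "emeasure \<rho> (A \<inter> B) = emeasure \<nu> A" "emeasure \<rho> (A \<inter> B) = emeasure \<nu>' A"
    if "A \<in> sets borel" for A
    using that B eq1[of "A \<inter> B"] eq2[of "A \<inter> B"]
      emeasure_density_lborel_null[of f B "A \<inter> B"] emeasure_density_lborel_null[of f' B "A \<inter> B"]
      emeasure_concentrated[OF sets(1) N(1,3) that _ B(1)]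
      emeasure_concentrated[OF sets(2) N'(1,3) that _ B(1)]
    by (auto simp: B_def)
  show \<nu>: "\<nu> = \<nu>'"
    by (rule measure_eqI) (use on_B sets in auto)
  have "density lborel f = density lborel f'"
  proof (rule measure_eqI)
    fix A assume "A \<in> sets (density lborel f)"
    then have A: "A \<in> sets borel" by simp
    have "emeasure \<rho> A \<noteq> \<infinity>" using finite_measure.emeasure_finite[OF fin] by simp
    then have "emeasure \<nu> A \<noteq> \<infinity>" using eq1[OF A] by auto
    then show "emeasure (density lborel f) A = emeasure (density lborel f') A"
      using eq1[OF A] eq2[OF A] \<nu> by (metis add.commute ennreal_add_left_cancel infinity_ennreal_def)
  qed simp
  then show "AE x in lborel. f x = f' x"
    by (intro sigma_finite_measure.density_unique[OF sigma_finite_lborel]) auto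
qed

text \<open>
  The set where the functions differ is open, and a nonempty open set is not negligible.
\<close>

lemma continuous_AE_eq_imp_eq:
  fixes u v :: "real \<Rightarrow> 'a::t2_space"
  assumes "continuous_on UNIV u" "continuous_on UNIV v" "AE x in lborel. u x = v x"
  shows "u = v"
proof -
  have op: "open {x. u x \<noteq> v x}" by (rule open_Collect_neq[OF assms(1,2)])
  then have "{x. u x \<noteq> v x} \<in> null_sets lborel"
    using assms(3) by (subst (asm) AE_iff_null) auto
  then have "negligible {x. u x \<noteq> v x}"
    by (simp add: negligible_iff_null_sets null_sets_completionI)
  with op have "{x. u x \<noteq> v x} = {}" using open_not_negligible by blast
  then show ?thesis by auto
qed

lemma is_gen_cont_density_unique:
  assumes "finite_measure \<rho>" "is_gen_cont_density \<rho> u" "is_gen_cont_density \<rho> v"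
  shows "u = v"
  using assms lebesgue_decomposition_unique(2)[OF assms(1)]
  by (auto simp: is_gen_cont_density_def intro!: continuous_AE_eq_imp_eq)

lemma M_plus_c_gen_cont_density:
  assumes "\<rho> \<in> M_plus_c"
  shows "is_gen_cont_density \<rho> (gen_cont_density \<rho>)"
proof -
  obtain u where "finite_measure \<rho>" "is_gen_cont_density \<rho> u"
    using assms by (auto simp: M_plus_c_def)
  then have "\<exists>!v. is_gen_cont_density \<rho> v"
    using is_gen_cont_density_unique by (intro ex1I[of _ u]) auto
  then show ?thesis unfolding gen_cont_density_def by (rule theI')
qed

lemma M_plus_c_decomposition:
  assumes "\<rho> \<in> M_plus_c"
  shows "lebesgue_decomposition \<rho> (gen_cont_density \<rho>) (singular_part \<rho>)"
proof -
  have fin: "finite_measure \<rho>" using assms by (simp add: M_plus_c_def)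
  obtain \<nu> where \<nu>: "lebesgue_decomposition \<rho> (gen_cont_density \<rho>) \<nu>"
    using M_plus_c_gen_cont_density[OF assms] by (auto simp: is_gen_cont_density_def)
  have "singular_part \<rho> = \<nu>"
    unfolding singular_part_def
  proof (rule the_equality)
    show "\<exists>f. lebesgue_decomposition \<rho> f \<nu>" using \<nu> by blast
    show "\<nu>' = \<nu>" if "\<exists>f. lebesgue_decomposition \<rho> f \<nu>'" for \<nu>'
      using that \<nu> lebesgue_decomposition_unique(1)[OF fin] by blast
  qed
  with \<nu> show ?thesis by simp
qed

text \<open>
  Cutting \<open>\<rho>\<close> along the null set \<open>N\<close> that carries the singular part separates the two parts. This gives
  them as densities with respect to \<open>\<rho>\<close>, so that integrals against them become integrals against \<open>\<rho>\<close>.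
\<close>

lemma lebesgue_decomposition_restrict:
  assumes sets: "sets \<rho> = sets borel" and dec: "lebesgue_decomposition \<rho> u \<nu>"
    and fin: "AE x in lborel. u x < \<infinity>"
  obtains N where "N \<in> sets borel" "emeasure lborel N = 0"
    "density \<rho> (\<lambda>x. ennreal (indicator N x)) = \<nu>"
    "density \<rho> (\<lambda>x. ennreal (indicator (- N) x)) = density lborel (\<lambda>x. ennreal (enn2real (u x)))"
proof -
  note [measurable_cong] = sets
  obtain N where N[measurable]: "N \<in> sets borel" and "emeasure lborel N = 0" "emeasure \<nu> (UNIV - N) = 0"
    using dec by (auto simp: lebesgue_decomposition_def)
  have [measurable]: "u \<in> borel_measurable borel" and sets_\<nu>: "sets \<nu> = sets borel"
    and eq: "\<And>A. A \<in> sets borel \<Longrightarrow> emeasure \<rho> A = emeasure (density lborel u) A + emeasure \<nu> A"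
    using dec by (auto simp: lebesgue_decomposition_def)
  have restrict: "emeasure (density \<rho> (\<lambda>x. ennreal (indicator B x))) A = emeasure \<rho> (A \<inter> B)"
    if [measurable]: "A \<in> sets borel" "B \<in> sets borel" for A B
    by (simp add: emeasure_density ennreal_indicator indicator_inter_arith[symmetric] Int_commute)
  have "density \<rho> (\<lambda>x. ennreal (indicator N x)) = \<nu>"
  proof (rule measure_eqI)
    fix A assume "A \<in> sets (density \<rho> (\<lambda>x. ennreal (indicator N x)))"
    then have A: "A \<in> sets borel" by (simp add: sets)
    then show "emeasure (density \<rho> (\<lambda>x. ennreal (indicator N x))) A = emeasure \<nu> A"
      using emeasure_concentrated[OF sets_\<nu> N \<open>emeasure \<nu> (UNIV - N) = 0\<close> A _ N]
        eq[of "A \<inter> N"] emeasure_density_lborel_null[of u N "A \<inter> N"] \<open>emeasure lborel N = 0\<close>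
      by (simp add: restrict)
  qed (simp add: sets sets_\<nu>)
  moreover have "density \<rho> (\<lambda>x. ennreal (indicator (- N) x)) = density lborel (\<lambda>x. ennreal (enn2real (u x)))"
  proof -
    have "density lborel (\<lambda>x. ennreal (enn2real (u x))) = density lborel u"
      using fin by (intro density_cong) (auto elim!: AE_mp)
    moreover have "density \<rho> (\<lambda>x. ennreal (indicator (- N) x)) = density lborel u"
    proof (rule measure_eqI)
      fix A assume "A \<in> sets (density \<rho> (\<lambda>x. ennreal (indicator (- N) x)))"
      then have A[measurable]: "A \<in> sets borel" by (simp add: sets)
      have "- N \<in> null_sets \<nu>" using \<open>emeasure \<nu> (UNIV - N) = 0\<close>
        by (auto simp: null_sets_def sets_\<nu> Compl_eq_Diff_UNIV)
      then have "A \<inter> - N \<in> null_sets \<nu>" by (rule null_sets_subset) (auto simp: sets_\<nu>)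
      then have 1: "emeasure \<nu> (A \<inter> - N) = 0" by (simp add: null_sets_def)
      have "emeasure (density lborel u) (A \<inter> N) = 0"
        using \<open>emeasure lborel N = 0\<close> by (intro emeasure_density_lborel_null[of u N]) auto
      then have "A \<inter> N \<in> null_sets (density lborel u)" by (auto simp: null_sets_def)
      moreover have "A = (A \<inter> - N) \<union> (A \<inter> N)" by auto
      ultimately have 2: "emeasure (density lborel u) A = emeasure (density lborel u) (A \<inter> - N)"
        using emeasure_Un_null_set[of "A \<inter> - N" "density lborel u" "A \<inter> N"] by simp
      show "emeasure (density \<rho> (\<lambda>x. ennreal (indicator (- N) x))) A = emeasure (density lborel u) A"
        using eq[of "A \<inter> - N"] 1 2 by (simp add: restrict)
    qed (simp add: sets)
    ultimately show ?thesis by simp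
  qed
  ultimately show ?thesis using that N \<open>emeasure lborel N = 0\<close> by blast
qed

lemma set_integral_decomposition:
  assumes sets: "sets \<rho> = sets borel" and dec: "lebesgue_decomposition \<rho> u \<nu>"
    and fin: "AE x in lborel. u x < \<infinity>"
  obtains N where "N \<in> sets borel" "emeasure lborel N = 0"
    "\<And>A h. A \<in> sets borel \<Longrightarrow> (h :: real \<Rightarrow> real) \<in> borel_measurable borel \<Longrightarrow>
       (LINT x:A|\<nu>. h x) = (LINT x:A \<inter> N|\<rho>. h x)"
    "\<And>A h. A \<in> sets borel \<Longrightarrow> (h :: real \<Rightarrow> real) \<in> borel_measurable borel \<Longrightarrow>
       (LINT x:A|lborel. enn2real (u x) * h x) = (LINT x:A - N|\<rho>. h x)"
proof -
  obtain N where N[measurable]: "N \<in> sets borel" and "emeasure lborel N = 0"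
    and \<nu>: "density \<rho> (\<lambda>x. ennreal (indicator N x)) = \<nu>"
    and u: "density \<rho> (\<lambda>x. ennreal (indicator (- N) x)) = density lborel (\<lambda>x. ennreal (enn2real (u x)))"
    using lebesgue_decomposition_restrict[OF assms] by blast
  note [measurable_cong] = sets
  have [measurable]: "u \<in> borel_measurable borel"
    using dec by (auto simp: lebesgue_decomposition_def)
  show ?thesis
  proof (rule that[OF N \<open>emeasure lborel N = 0\<close>])
    fix A :: "real set" and h :: "real \<Rightarrow> real"
    assume [measurable]: "A \<in> sets borel" "h \<in> borel_measurable borel"
    show "(LINT x:A|\<nu>. h x) = (LINT x:A \<inter> N|\<rho>. h x)"
      unfolding set_lebesgue_integral_def \<nu>[symmetric]
      by (subst integral_density)
         (auto intro!: Bochner_Integration.integral_cong simp: indicator_def)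
    have "(LINT x:A|lborel. enn2real (u x) * h x)
        = (\<integral>x. indicator A x * h x \<partial>density lborel (\<lambda>x. ennreal (enn2real (u x))))"
      by (subst integral_density)
         (auto simp: set_lebesgue_integral_def mult_ac intro!: Bochner_Integration.integral_cong)
    also have "\<dots> = (LINT x:A - N|\<rho>. h x)"
      unfolding u[symmetric] set_lebesgue_integral_def
      by (subst integral_density)
         (auto intro!: Bochner_Integration.integral_cong simp: indicator_def)
    finally show "(LINT x:A|lborel. enn2real (u x) * h x) = (LINT x:A - N|\<rho>. h x)" .
  qed
qed

lemma integral_lebesgue_decomposition:
  fixes h :: "real \<Rightarrow> real"
  assumes sets: "sets \<rho> = sets borel" and dec: "lebesgue_decomposition \<rho> u \<nu>"
    and fin: "AE x in lborel. u x < \<infinity>" and int: "integrable \<rho> h"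
  shows "(\<integral>x. h x \<partial>\<rho>) = (\<integral>x. enn2real (u x) * h x \<partial>lborel) + (\<integral>x. h x \<partial>\<nu>)"
proof -
  obtain N where N: "N \<in> sets borel"
    and eq: "\<And>A h. A \<in> sets borel \<Longrightarrow> (h :: real \<Rightarrow> real) \<in> borel_measurable borel \<Longrightarrow>
       (LINT x:A|\<nu>. h x) = (LINT x:A \<inter> N|\<rho>. h x)"
    "\<And>A h. A \<in> sets borel \<Longrightarrow> (h :: real \<Rightarrow> real) \<in> borel_measurable borel \<Longrightarrow>
       (LINT x:A|lborel. enn2real (u x) * h x) = (LINT x:A - N|\<rho>. h x)"
    by (rule set_integral_decomposition[OF assms(1-3)]) (rule that, assumption+)
  have h: "h \<in> borel_measurable borel"
    using int by (auto simp: measurable_cong_sets[OF sets refl] dest!: borel_measurable_integrable)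
  have set_int: "set_integrable \<rho> A h" if "A \<in> sets borel" for A
    unfolding set_integrable_def using that sets int by (intro integrable_mult_indicator) auto
  have "(LINT x:(UNIV - N) \<union> (UNIV \<inter> N)|\<rho>. h x) = (LINT x:UNIV - N|\<rho>. h x) + (LINT x:UNIV \<inter> N|\<rho>. h x)"
    using N by (intro set_integral_Un set_int) auto
  also have "\<dots> = (LINT x:UNIV|lborel. enn2real (u x) * h x) + (LINT x:UNIV|\<nu>. h x)"
    using eq[OF _ h, of UNIV] by simp
  finally show ?thesis by (simp add: set_lebesgue_integral_def)
qed

lemma continuous_on_beta_ext:
  assumes cont: "continuous_on {0..} \<beta>" and lim: "(\<beta> \<longlongrightarrow> l) at_top"
  shows "continuous_on UNIV (beta_ext \<beta>)"
proof (rule continuous_at_imp_continuous_on, rule ballI)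
  fix r :: ennreal
  have Lim: "Lim at_top \<beta> = l" using lim by (intro tendsto_Lim) auto
  show "isCont (beta_ext \<beta>) r"
  proof (cases r)
    case (real x)
    have "((\<lambda>y. enn2real y) \<longlongrightarrow> x) (at r)"
      using real by (intro tendsto_enn2real) auto
    then have "((\<lambda>y. \<beta> (enn2real y)) \<longlongrightarrow> \<beta> x) (at r)"
      using real by (intro continuous_on_tendsto_compose[OF cont]) auto
    moreover have "\<forall>\<^sub>F y in at r. y < \<infinity>"
      using real by (intro order_tendstoD(2)[OF tendsto_ident_at]) auto
    then have "\<forall>\<^sub>F y in at r. \<beta> (enn2real y) = beta_ext \<beta> y"
      by (rule eventually_mono) (auto simp: beta_ext_def)
    ultimately have "(beta_ext \<beta> \<longlongrightarrow> \<beta> x) (at r)" by (rule Lim_transform_eventually)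
    then show ?thesis using real by (simp add: isCont_def beta_ext_def)
  next
    case top
    have "(beta_ext \<beta> \<longlongrightarrow> l) (at r)"
    proof (rule tendstoI)
      fix e :: real assume "0 < e"
      with tendstoD[OF lim this] obtain B where B: "\<And>x. B \<le> x \<Longrightarrow> dist (\<beta> x) l < e"
        unfolding eventually_at_top_linorder by blast
      have "\<forall>\<^sub>F y in at r. ennreal B < y"
        using top by (intro order_tendstoD(1)[OF tendsto_ident_at]) auto
      then show "\<forall>\<^sub>F y in at r. dist (beta_ext \<beta> y) l < e"
      proof (rule eventually_mono)
        fix y assume y: "ennreal B < y"
        show "dist (beta_ext \<beta> y) l < e"
        proof (cases y)
          case (real z)
          then have "B \<le> z" using y real ennreal_leI[of z B] by (metis leD linear)
          then show ?thesis using B real by (simp add: beta_ext_def)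
        next
          case top
          then show ?thesis using \<open>0 < e\<close> by (simp add: beta_ext_def Lim)
        qed
      qed
    qed
    then show ?thesis using top by (simp add: isCont_def beta_ext_def Lim)
  qed
qed

section \<open>Integration of continuous and compactly supported functions\<close>

lemma frechet_derivative_eq_deriv:
  fixes f :: "real \<Rightarrow> real"
  assumes "f differentiable (at x)"
  shows "frechet_derivative f (at x) v = deriv f x * v"
proof -
  have "(f has_real_derivative deriv f x) (at x)"
    using assms DERIV_deriv_iff_real_differentiable by blast
  then have "(*) (deriv f x) = frechet_derivative f (at x)"
    by (intro frechet_derivative_at) (simp add: has_field_derivative_def)
  then show ?thesis by (metis)
qed

lemma continuous_deriv_of_Ck_on:
  assumes "Ck_on 2 UNIV (f :: real \<Rightarrow> real)"
  shows "continuous_on UNIV (deriv f)"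
proof -
  have diff: "f differentiable (at x)" for x
    using assms by (simp add: numeral_2_eq_2)
  have "(\<lambda>x. frechet_derivative f (at x) 1) differentiable (at x)" for x
    using assms by (simp add: numeral_2_eq_2)
  then have "continuous_on UNIV (\<lambda>x. frechet_derivative f (at x) 1)"
    by (auto intro!: continuous_at_imp_continuous_on differentiable_imp_continuous_within)
  then show ?thesis by (simp add: frechet_derivative_eq_deriv[OF diff])
qed

lemma set_integrable_continuous_Ioc:
  fixes h :: "real \<Rightarrow> real"
  assumes "finite_measure M" and sets: "sets M = sets borel" and "continuous_on UNIV h"
  shows "set_integrable M {a<..b} h"
proof -
  have "compact (h ` {a..b})"
    by (rule compact_continuous_image[OF continuous_on_subset[OF assms(3)]]) auto
  then obtain B where B: "\<And>x. x \<in> {a..b} \<Longrightarrow> \<bar>h x\<bar> \<le> B"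
    using compact_imp_bounded by (fastforce simp: bounded_iff)
  have [measurable]: "h \<in> borel_measurable borel"
    by (rule borel_measurable_continuous_onI[OF assms(3)])
  note [measurable_cong] = sets
  have "AE x in M. norm (indicator {a<..b} x *\<^sub>R h x) \<le> \<bar>B\<bar>"
  proof (rule AE_I2)
    fix x
    show "norm (indicator {a<..b} x *\<^sub>R h x) \<le> \<bar>B\<bar>"
      using B[of x] by (cases "x \<in> {a<..b}") auto
  qed
  then show ?thesis
    unfolding set_integrable_def
    by (rule finite_measure.integrable_const_bound[OF assms(1)]) measurable
qed

lemma integrable_finite_continuous_compact_support:
  fixes h :: "real \<Rightarrow> real"
  assumes "finite_measure M" "sets M = sets borel" "continuous_on UNIV h" "\<And>x. x \<notin> {p..q} \<Longrightarrow> h x = 0"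
  shows "integrable M h"
proof -
  have "set_integrable M {p - 1<..q} h" by (rule set_integrable_continuous_Ioc[OF assms(1-3)])
  moreover have "indicator {p - 1<..q} x *\<^sub>R h x = h x" for x
    using assms(4)[of x] by (cases "x \<in> {p..q}") auto
  ultimately show ?thesis unfolding set_integrable_def by (simp only:)
qed

lemma integral_derivative_compact_support:
  fixes h :: "real \<Rightarrow> real"
  assumes der: "\<And>x. (h has_real_derivative h' x) (at x)" and cont: "continuous_on UNIV h'"
    and h: "\<And>x. x \<notin> {p..q} \<Longrightarrow> h x = 0" and h': "\<And>x. x \<notin> {p..q} \<Longrightarrow> h' x = 0"
  shows "(\<integral>x. h' x \<partial>lborel) = 0"
proof -
  define P Q where "P = min p q - 1" and "Q = max p q + 1"
  have "(\<integral>x. h' x * indicator {P..Q} x \<partial>lborel) = h Q - h P"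
    using der cont by (intro integral_FTC_Icc_real) (auto simp: P_def Q_def continuous_on_eq_continuous_at)
  moreover have "h Q = 0" "h P = 0" by (rule h, auto simp: P_def Q_def)+
  moreover have "h' x * indicator {P..Q} x = h' x" for x
    using h'[of x] by (cases "x \<in> {p..q}") (auto simp: P_def Q_def)
  ultimately show ?thesis by simp
qed

lemma integral_plateau_pos: "0 < (\<integral>t. plateau 1 2 1 t \<partial>lborel)"
proof -
  have int: "integrable lborel (plateau 1 2 1)"
    by (rule integrable_continuous_compact_support[of _ 1 3]) (auto intro: continuous_plateau plateau_outside)
  have nonneg: "0 \<le> plateau 1 2 1 t" for t by (intro plateau_bounds) auto
  have "(\<integral>t. plateau 1 2 1 t \<partial>lborel) \<noteq> 0"
  proof
    assume "(\<integral>t. plateau 1 2 1 t \<partial>lborel) = 0"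
    then have "AE t in lborel. plateau 1 2 1 t = 0"
      using integral_nonneg_eq_0_iff_AE[OF int] nonneg by auto
    then have "plateau 1 2 1 = (\<lambda>_. 0)"
      by (intro continuous_AE_eq_imp_eq continuous_plateau) auto
    then have "plateau 1 2 1 2 = 0" by metis
    then show False by (simp add: plateau_def step_ge_1 step_nonpos)
  qed
  moreover have "0 \<le> (\<integral>t. plateau 1 2 1 t \<partial>lborel)"
    using nonneg by (intro Bochner_Integration.integral_nonneg) auto
  ultimately show ?thesis by simp
qed

section \<open>Dissipation and flux\<close>

locale stationary_setting =
  fixes \<beta> V :: "real \<Rightarrow> real" and m :: real and \<rho> :: "real measure"
  assumes \<beta>_cont: "continuous_on {0..} \<beta>" and \<beta>_0: "\<beta> 0 = 0" and \<beta>_lim: "\<exists>l. (\<beta> \<longlongrightarrow> l) at_top"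
    and V'_cont: "continuous_on UNIV (deriv V)"
    and \<rho>_M2: "\<rho> \<in> M2 m"
begin

abbreviation u :: "real \<Rightarrow> ennreal" where "u \<equiv> gen_cont_density \<rho>"
abbreviation r :: "real \<Rightarrow> real" where "r x \<equiv> enn2real (u x)"
abbreviation g :: "real \<Rightarrow> real" where "g \<equiv> weak_deriv (beta_density \<beta> \<rho>)"
abbreviation V' :: "real \<Rightarrow> real" where "V' \<equiv> deriv V"

lemma sets_\<rho>: "sets \<rho> = sets borel" and emeasure_\<rho>: "emeasure \<rho> UNIV = ennreal m"
  using \<rho>_M2 by (auto simp: M2_def)

lemma space_\<rho>: "space \<rho> = UNIV"
  using sets_eq_imp_space_eq[OF sets_\<rho>] by simp

lemma finite_\<rho>: "finite_measure \<rho>"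
  by (rule finite_measureI) (simp add: space_\<rho> emeasure_\<rho>)

lemma V'_measurable: "V' \<in> borel_measurable borel"
  by (rule borel_measurable_continuous_onI[OF V'_cont])

lemma V'_set_integrable: "set_integrable \<rho> {a<..b} V'"
  by (rule set_integrable_continuous_Ioc[OF finite_\<rho> sets_\<rho> V'_cont])

end

text \<open>
  The measures whose dissipation is given by the integral formula rather than set to infinity.
\<close>

locale regular_setting = stationary_setting +
  assumes \<rho>_M: "\<rho> \<in> M_plus_c" and W11: "beta_density \<beta> \<rho> \<in> W11_loc"
begin

lemma is_weak_deriv_g: "is_weak_deriv (beta_density \<beta> \<rho>) g"
proof -
  obtain h where "is_weak_deriv (beta_density \<beta> \<rho>) h"
    using W11 by (auto simp: W11_loc_def)
  then show ?thesis unfolding weak_deriv_def by (rule someI[of "is_weak_deriv (beta_density \<beta> \<rho>)"])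
qed

lemma g_locally_integrable: "locally_integrable g"
  using is_weak_deriv_g by (simp add: is_weak_deriv_def)

lemma g_measurable: "g \<in> borel_measurable borel"
  by (rule locally_integrable_measurable[OF g_locally_integrable])

lemma decomposition: "lebesgue_decomposition \<rho> u (singular_part \<rho>)"
  by (rule M_plus_c_decomposition[OF \<rho>_M])

lemma sets_singular: "sets (singular_part \<rho>) = sets borel"
  using decomposition by (simp add: lebesgue_decomposition_def)

lemma u_cont: "continuous_on UNIV u"
  using M_plus_c_gen_cont_density[OF \<rho>_M] by (simp add: is_gen_cont_density_def)

lemma u_measurable: "u \<in> borel_measurable borel"
  using decomposition by (simp add: lebesgue_decomposition_def)

lemma u_finite: "AE x in lborel. u x < \<infinity>"
proof -
  have [measurable]: "u \<in> borel_measurable borel" by (rule u_measurable)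
  have "UNIV - {x. u x < \<infinity>} \<in> null_sets lborel"
    using M_plus_c_gen_cont_density[OF \<rho>_M] by (auto simp: is_gen_cont_density_def null_sets_def)
  then show ?thesis by (rule AE_I') auto
qed

lemma u_integral: "(\<integral>\<^sup>+x. u x \<partial>lborel) < \<infinity>"
  using lebesgue_decomposition_finite[OF finite_\<rho> decomposition] by (simp add: less_top)

text \<open>
  Since \<open>\<beta>(0) = 0\<close>, the set \<open>{u = 0}\<close> is contained in the zero set of the continuous function \<open>\<beta>(u)\<close>. The
  dissipation does not see \<open>{u = 0}\<close>, so this is the only control on the flux there.
\<close>

lemma g_zero: "AE x in lborel. u x = 0 \<longrightarrow> g x = 0"
proof -
  obtain l where "(\<beta> \<longlongrightarrow> l) at_top" using \<beta>_lim by blast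
  then have "continuous_on UNIV (beta_density \<beta> \<rho>)"
    unfolding beta_density_def
    by (intro continuous_on_compose2[OF continuous_on_beta_ext[OF \<beta>_cont] u_cont]) auto
  from weak_deriv_zero_on_zero_set[OF this is_weak_deriv_g]
  show ?thesis by (rule AE_mp) (auto simp: beta_density_def beta_ext_def \<beta>_0)
qed

lemma dissipation_eq:
  "dissipation \<beta> V \<rho> =
     (\<integral>\<^sup>+x. ennreal (\<bar>g x / r x + V' x\<bar>\<^sup>2 * r x) * indicator {x. 0 < u x \<and> u x < \<infinity>} x \<partial>lborel)
     + (\<integral>\<^sup>+x. ennreal (\<bar>V' x\<bar>\<^sup>2) \<partial>singular_part \<rho>)"
  using \<rho>_M W11 by (simp add: dissipation_def)

text \<open>
  Zero dissipation says that the flux \<open>r V' + g\<close> vanishes on \<open>{0 < u < \<infinity>}\<close>; on \<open>{u = 0}\<close> both of its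
  summands vanish, and \<open>{u = \<infinity>}\<close> is a null set.
\<close>

lemma dissipation_eq_0_iff:
  "dissipation \<beta> V \<rho> = 0 \<longleftrightarrow>
     (AE x in lborel. g x = - (r x * V' x)) \<and> (AE x in singular_part \<rho>. V' x = 0)"
proof -
  have [measurable]: "u \<in> borel_measurable borel" "g \<in> borel_measurable borel" "V' \<in> borel_measurable borel"
    by (intro u_measurable g_measurable V'_measurable)+
  note [measurable_cong] = sets_singular
  have "(\<integral>\<^sup>+x. ennreal (\<bar>g x / r x + V' x\<bar>\<^sup>2 * r x) * indicator {x. 0 < u x \<and> u x < \<infinity>} x \<partial>lborel) = 0
      \<longleftrightarrow> (AE x in lborel. ennreal (\<bar>g x / r x + V' x\<bar>\<^sup>2 * r x) * indicator {x. 0 < u x \<and> u x < \<infinity>} x = 0)"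
    by (rule nn_integral_0_iff_AE) measurable
  also have "\<dots> \<longleftrightarrow> (AE x in lborel. g x = - (r x * V' x))"
  proof (rule eventually_subst)
    show "AE x in lborel. (ennreal (\<bar>g x / r x + V' x\<bar>\<^sup>2 * r x) * indicator {x. 0 < u x \<and> u x < \<infinity>} x = 0)
        = (g x = - (r x * V' x))"
      using u_finite g_zero
    proof eventually_elim
      case (elim x)
      show ?case
      proof (cases "u x = 0")
        case False
        then have "0 < r x" using elim(1) by (simp add: enn2real_positive_iff zero_less_iff_neq_zero)
        then show ?thesis using elim False
          by (auto simp: zero_less_iff_neq_zero ennreal_eq_0_iff mult_le_0_iff field_simps add_eq_0_iff2)
      qed (use elim in auto)
    qed
  qed
  finally show ?thesis
    unfolding dissipation_eq by (simp add: add_eq_0_iff_both_eq_0 nn_integral_0_iff_AE)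
qed

text \<open>
  The hypothesis says that the signed measure \<open>V' \<rho> + g \<L>\<^sup>1\<close>, smoothed on the interval from \<open>a\<close> to \<open>b\<close>,
  has \<open>b - a\<close> times the value it has on the unit interval. In the limit \<open>e \<rightarrow> 0\<close> it equals \<open>c \<L>\<^sup>1\<close> on
  all half-open intervals, hence on all bounded Borel sets. Evaluating this on subsets of the null set
  \<open>N\<close> carrying the singular part, and off \<open>N\<close>, gives the two conclusions.
\<close>

lemma flux_constant:
  assumes weak: "\<And>a b e. a \<le> b \<Longrightarrow> 0 < e \<Longrightarrow>
      (\<integral>x. (plateau a b e x - (b - a) * plateau 0 1 e x) * V' x \<partial>\<rho>)
      + (\<integral>x. (plateau a b e x - (b - a) * plateau 0 1 e x) * g x \<partial>lborel) = 0"
  obtains c where "AE x in lborel. r x * V' x + g x = c" "AE x in singular_part \<rho>. V' x = 0"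
proof -
  \<comment> \<open>The candidate constant is the total flux through the unit interval.\<close>
  define F where "F a b = (LINT x:{a<..b}|\<rho>. V' x) + (LINT x:{a<..b}|lborel. g x)" for a b
  define c where "c = F 0 1"
  have F: "F a b = (b - a) * c" if "a \<le> b" for a b
  proof -
    let ?e = "\<lambda>n. 1 / real (Suc n)"
    note p\<rho> = plateau_integral_tendsto[OF sets_\<rho> V'_set_integrable]
    note pg = plateau_integral_tendsto[OF sets_lborel locally_integrable_Ioc[OF g_locally_integrable]]
    have "(\<integral>x. (plateau a b (?e n) x - (b - a) * plateau 0 1 (?e n) x) * V' x \<partial>\<rho>)
       = (\<integral>x. plateau a b (?e n) x * V' x \<partial>\<rho>) - (b - a) * (\<integral>x. plateau 0 1 (?e n) x * V' x \<partial>\<rho>)" for n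
    proof -
      have "(\<integral>x. (plateau a b (?e n) x - (b - a) * plateau 0 1 (?e n) x) * V' x \<partial>\<rho>)
        = (\<integral>x. plateau a b (?e n) x * V' x - (b - a) * (plateau 0 1 (?e n) x * V' x) \<partial>\<rho>)"
        by (intro Bochner_Integration.integral_cong) (auto simp: algebra_simps)
      also have "\<dots> = (\<integral>x. plateau a b (?e n) x * V' x \<partial>\<rho>) - (\<integral>x. (b - a) * (plateau 0 1 (?e n) x * V' x) \<partial>\<rho>)"
        by (intro Bochner_Integration.integral_diff integrable_mult_right p\<rho>(1) that) simp
      finally show ?thesis by simp
    qed
    moreover have "(\<integral>x. (plateau a b (?e n) x - (b - a) * plateau 0 1 (?e n) x) * g x \<partial>lborel)
       = (\<integral>x. plateau a b (?e n) x * g x \<partial>lborel) - (b - a) * (\<integral>x. plateau 0 1 (?e n) x * g x \<partial>lborel)" for n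
    proof -
      have "(\<integral>x. (plateau a b (?e n) x - (b - a) * plateau 0 1 (?e n) x) * g x \<partial>lborel)
        = (\<integral>x. plateau a b (?e n) x * g x - (b - a) * (plateau 0 1 (?e n) x * g x) \<partial>lborel)"
        by (intro Bochner_Integration.integral_cong) (auto simp: algebra_simps)
      also have "\<dots> = (\<integral>x. plateau a b (?e n) x * g x \<partial>lborel) - (\<integral>x. (b - a) * (plateau 0 1 (?e n) x * g x) \<partial>lborel)"
        by (intro Bochner_Integration.integral_diff integrable_mult_right pg(1) that) simp
      finally show ?thesis by simp
    qed
    ultimately have zero: "((\<integral>x. plateau a b (?e n) x * V' x \<partial>\<rho>) - (b - a) * (\<integral>x. plateau 0 1 (?e n) x * V' x \<partial>\<rho>))
       + ((\<integral>x. plateau a b (?e n) x * g x \<partial>lborel) - (b - a) * (\<integral>x. plateau 0 1 (?e n) x * g x \<partial>lborel)) = 0" for n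
      using weak[OF that, of "?e n"] by simp
    have "(\<lambda>n. ((\<integral>x. plateau a b (?e n) x * V' x \<partial>\<rho>) - (b - a) * (\<integral>x. plateau 0 1 (?e n) x * V' x \<partial>\<rho>))
       + ((\<integral>x. plateau a b (?e n) x * g x \<partial>lborel) - (b - a) * (\<integral>x. plateau 0 1 (?e n) x * g x \<partial>lborel)))
       \<longlonglongrightarrow> ((LINT x:{a<..b}|\<rho>. V' x) - (b - a) * (LINT x:{0<..1}|\<rho>. V' x))
        + ((LINT x:{a<..b}|lborel. g x) - (b - a) * (LINT x:{0<..1}|lborel. g x))"
      by (intro tendsto_intros p\<rho>(2) pg(2) that) simp_all
    then show ?thesis
      unfolding zero by (simp add: F_def c_def algebra_simps LIMSEQ_const_iff)
  qed
  have const: "set_integrable lborel {a<..b} (\<lambda>_. c)" for a b :: real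
    by (rule set_integrable_subset[OF borel_integrable_atLeastAtMost'[of a b]]) auto
  have int_c: "set_integrable lborel {a<..b} (\<lambda>x. c - g x)" for a b
    by (intro set_integral_diff(1) const locally_integrable_Ioc[OF g_locally_integrable])
  \<comment> \<open>Lebesgue terms are moved to one side, so that each side is an integral for a single measure.\<close>
  have eq: "(LINT x:A|\<rho>. V' x) = (LINT x:A|lborel. c - g x)" if "A \<in> sets borel" "A \<subseteq> {p<..q}" for A p q
  proof (rule set_integral_eq_of_Ioc[OF sets_\<rho> sets_lborel V'_set_integrable int_c _ that])
    fix a b :: real assume "a < b"
    have "(LINT x:{a<..b}|lborel. c - g x) = (LINT x:{a<..b}|lborel. c) - (LINT x:{a<..b}|lborel. g x)"
      by (intro set_integral_diff(2) const locally_integrable_Ioc[OF g_locally_integrable])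
    moreover have "(LINT x:{a<..b}|lborel. c) = (b - a) * c"
      using \<open>a < b\<close> by (simp add: set_lebesgue_integral_def)
    ultimately show "(LINT x:{a<..b}|\<rho>. V' x) = (LINT x:{a<..b}|lborel. c - g x)"
      using F[of a b] \<open>a < b\<close> by (simp add: F_def)
  qed
  obtain N where N: "N \<in> sets borel" "emeasure lborel N = 0"
    and split: "\<And>A h. A \<in> sets borel \<Longrightarrow> (h :: real \<Rightarrow> real) \<in> borel_measurable borel \<Longrightarrow>
       (LINT x:A|singular_part \<rho>. h x) = (LINT x:A \<inter> N|\<rho>. h x)"
    "\<And>A h. A \<in> sets borel \<Longrightarrow> (h :: real \<Rightarrow> real) \<in> borel_measurable borel \<Longrightarrow>
       (LINT x:A|lborel. r x * h x) = (LINT x:A - N|\<rho>. h x)"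
    by (rule set_integral_decomposition[OF sets_\<rho> decomposition u_finite]) (rule that, assumption+)
  have AE_N: "AE x in lborel. x \<notin> N" using N by (intro AE_not_in) (auto simp: null_sets_def)
  have fin_sing: "finite_measure (singular_part \<rho>)"
  proof (rule finite_measureI)
    have "emeasure \<rho> UNIV = emeasure (density lborel u) UNIV + emeasure (singular_part \<rho>) UNIV"
      using decomposition by (simp add: lebesgue_decomposition_def)
    then have "emeasure (singular_part \<rho>) UNIV \<le> ennreal m"
      unfolding emeasure_\<rho> by simp
    then show "emeasure (singular_part \<rho>) (space (singular_part \<rho>)) \<noteq> \<infinity>"
      using sets_eq_imp_space_eq[OF sets_singular] by (auto simp: top_unique)
  qed
  have sing: "AE x in singular_part \<rho>. V' x = 0"
  proof (rule AE_zero_of_set_integrals[OF _ sets_singular])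
    show "sigma_finite_measure (singular_part \<rho>)" using fin_sing by (rule finite_measure.axioms)
    show "set_integrable (singular_part \<rho>) {a<..b} V'" for a b
      by (rule set_integrable_continuous_Ioc[OF fin_sing sets_singular V'_cont])
    fix A p q assume A: "A \<in> sets borel" "A \<subseteq> {p<..q::real}"
    have "(LINT x:A \<inter> N|lborel. c - g x) = 0"
      unfolding set_lebesgue_integral_def
      by (rule integral_eq_zero_AE) (use AE_N in eventually_elim, simp)
    then show "(LINT x:A|singular_part \<rho>. V' x) = 0"
      using split(1)[OF A(1) V'_measurable] eq[of "A \<inter> N" p q] A N by (simp add: subset_iff)
  qed
  have ac: "AE x in lborel. r x * V' x - (c - g x) = 0"
  proof (rule AE_zero_of_set_integrals[OF sigma_finite_lborel sets_lborel])
    have r_int: "integrable lborel r"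
    proof (rule integrableI_nonneg)
      show "r \<in> borel_measurable lborel" using u_measurable by simp
      have "(\<integral>\<^sup>+x. ennreal (r x) \<partial>lborel) = (\<integral>\<^sup>+x. u x \<partial>lborel)"
        by (rule nn_integral_cong_AE) (use u_finite in eventually_elim, simp)
      then show "(\<integral>\<^sup>+x. ennreal (r x) \<partial>lborel) < \<infinity>" using u_integral by simp
    qed simp
    then have "locally_integrable r"
      unfolding locally_integrable_def set_integrable_def
      by (intro allI impI integrable_mult_indicator) (simp_all add: borel_compact)
    from locally_integrable_Ioc[OF locally_integrable_continuous_mult[OF V'_cont this]]
    have rV: "set_integrable lborel {a<..b} (\<lambda>x. r x * V' x)" for a b by (simp add: mult.commute)
    then show "set_integrable lborel {a<..b} (\<lambda>x. r x * V' x - (c - g x))" for a b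
      by (intro set_integral_diff(1) int_c)
    fix A p q assume A: "A \<in> sets borel" "A \<subseteq> {p<..q::real}"
    have "(LINT x:A|lborel. r x * V' x - (c - g x)) = (LINT x:A|lborel. r x * V' x) - (LINT x:A|lborel. c - g x)"
      using A by (intro set_integral_diff(2) set_integrable_subset[OF rV, of A] set_integrable_subset[OF int_c, of A]) auto
    also have "(LINT x:A|lborel. c - g x) = (LINT x:A - N|lborel. c - g x)"
      unfolding set_lebesgue_integral_def
      using A N g_measurable by (intro integral_cong_AE) (use AE_N in \<open>auto simp: indicator_def\<close>)
    also have "\<dots> = (LINT x:A|lborel. r x * V' x)"
      using split(2)[OF A(1) V'_measurable] eq[of "A - N" p q] A N by (simp add: subset_iff)
    finally show "(LINT x:A|lborel. r x * V' x - (c - g x)) = 0" by simp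
  qed
  show ?thesis
    by (rule that[of c, OF _ sing]) (use ac in eventually_elim, simp)
qed

text \<open>
  If \<open>c \<noteq> 0\<close>, then \<open>u > 0\<close> almost everywhere, because \<open>g\<close> and hence the flux vanish where \<open>u\<close> does,
  and the integrand of the dissipation is \<open>c\<^sup>2 / u\<close>. Thus both \<open>u\<close> and \<open>1/u\<close> would be integrable over
  the real line, which contradicts \<open>1 \<le> u + 1/u\<close>.
\<close>

lemma flux_zero:
  assumes flux: "AE x in lborel. r x * V' x + g x = c" and fin: "dissipation \<beta> V \<rho> < \<infinity>"
  shows "c = 0"
proof (rule ccontr)
  assume "c \<noteq> 0"
  have [measurable]: "u \<in> borel_measurable borel" "g \<in> borel_measurable borel" "V' \<in> borel_measurable borel"
    by (intro u_measurable g_measurable V'_measurable)+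
  let ?D = "\<lambda>x. ennreal (\<bar>g x / r x + V' x\<bar>\<^sup>2 * r x) * indicator {x. 0 < u x \<and> u x < \<infinity>} x"
  have D: "(\<integral>\<^sup>+x. ?D x \<partial>lborel) < \<infinity>"
    using fin unfolding dissipation_eq by (auto simp: less_top)
  have "AE x in lborel. 1 \<le> u x + ennreal (1 / c\<^sup>2) * ?D x"
    using flux u_finite g_zero
  proof eventually_elim
    case (elim x)
    then have "u x \<noteq> 0" using \<open>c \<noteq> 0\<close> by auto
    with elim(2) have r: "0 < r x" "u x = ennreal (r x)"
      by (simp_all add: enn2real_positive_iff zero_less_iff_neq_zero)
    have "g x / r x + V' x = c / r x" using elim(1) r(1) by (simp add: field_simps)
    then have "?D x = ennreal (c\<^sup>2 / r x)"
      using \<open>u x \<noteq> 0\<close> elim(2) r(1)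
      by (simp add: zero_less_iff_neq_zero power_divide power2_eq_square field_simps)
    then have "ennreal (1 / c\<^sup>2) * ?D x = ennreal (1 / r x)"
      using r \<open>c \<noteq> 0\<close> by (simp only:) (simp add: ennreal_mult[symmetric])
    then have eq: "u x + ennreal (1 / c\<^sup>2) * ?D x = ennreal (r x + 1 / r x)"
      using r(1) by (simp only:) (simp add: r(2)[symmetric])
    have "0 \<le> (r x - 1)\<^sup>2" by simp
    then have "r x \<le> r x * r x + 1" using r(1) by (simp add: power2_eq_square algebra_simps)
    then have "1 \<le> r x + 1 / r x" using r(1) by (simp add: field_simps)
    then show ?case unfolding eq by (metis ennreal_1 ennreal_leI)
  qed
  then have "(\<integral>\<^sup>+x. 1 \<partial>(lborel :: real measure)) \<le> (\<integral>\<^sup>+x. u x + ennreal (1 / c\<^sup>2) * ?D x \<partial>lborel)"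
    by (rule nn_integral_mono_AE)
  also have "\<dots> = (\<integral>\<^sup>+x. u x \<partial>lborel) + ennreal (1 / c\<^sup>2) * (\<integral>\<^sup>+x. ?D x \<partial>lborel)"
    by (subst nn_integral_add, measurable, subst nn_integral_cmult) auto
  also have "\<dots> < \<infinity>" using u_integral D by (auto simp: ennreal_mult_less_top less_top)
  finally show False by simp
qed

end

section \<open>Test functions of time and space\<close>

lemma continuous_compact_support_bounded:
  fixes H :: "'a::topological_space \<Rightarrow> real"
  assumes "continuous_on UNIV H" "compact K" "\<And>z. z \<notin> K \<Longrightarrow> H z = 0"
  obtains B where "\<And>z. \<bar>H z\<bar> \<le> B"
proof -
  have "compact (H ` K)"
    by (rule compact_continuous_image[OF continuous_on_subset[OF assms(1)] assms(2)]) simp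
  then obtain B where B: "\<And>z. z \<in> K \<Longrightarrow> \<bar>H z\<bar> \<le> B"
    using compact_imp_bounded by (fastforce simp: bounded_iff)
  have "\<bar>H z\<bar> \<le> \<bar>B\<bar>" for z
    using B[of z] assms(3)[of z] by (cases "z \<in> K") auto
  then show ?thesis by (rule that)
qed

lemma integrable_pair_continuous_compact_support:
  fixes H :: "real \<times> real \<Rightarrow> real"
  assumes \<rho>: "finite_measure \<rho>" and sets: "sets \<rho> = sets borel"
    and cont: "continuous_on UNIV H" and K: "compact K" "\<And>z. z \<notin> K \<Longrightarrow> H z = 0"
  shows "integrable (lborel \<Otimes>\<^sub>M \<rho>) H"
proof -
  interpret finite_measure \<rho> by (rule \<rho>)
  obtain B where B: "\<And>z. \<bar>H z\<bar> \<le> B"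
    using continuous_compact_support_bounded[OF cont K] by blast
  have "compact (fst ` K)" by (intro compact_continuous_image continuous_intros K(1))
  then obtain R where R: "\<And>t. t \<in> fst ` K \<Longrightarrow> \<bar>t\<bar> \<le> R"
    using compact_imp_bounded by (fastforce simp: bounded_iff)
  have sets_pair: "sets (lborel \<Otimes>\<^sub>M \<rho>) = sets (borel :: (real \<times> real) measure)"
    unfolding borel_prod[symmetric] by (intro sets_pair_measure_cong) (simp_all add: sets)
  show ?thesis
  proof (rule integrableI_bounded_set[where A = "{-R..R} \<times> UNIV" and B = B])
    show "{-R..R} \<times> UNIV \<in> sets (lborel \<Otimes>\<^sub>M \<rho>)"
      using sets by (intro pair_measureI) auto
    show "H \<in> borel_measurable (lborel \<Otimes>\<^sub>M \<rho>)"
      using borel_measurable_continuous_onI[OF cont]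
      by (simp only: measurable_cong_sets[OF sets_pair refl])
    have "emeasure (lborel \<Otimes>\<^sub>M \<rho>) ({-R..R} \<times> UNIV) = emeasure lborel {-R..R} * emeasure \<rho> UNIV"
      using sets by (intro emeasure_pair_measure_Times) auto
    also have "\<dots> < \<infinity>"
    proof -
      have "emeasure \<rho> UNIV < top" using emeasure_finite[of UNIV] by (simp add: less_top[symmetric])
      then show ?thesis by (simp add: ennreal_mult_less_top emeasure_lborel_Icc_eq)
    qed
    finally show "emeasure (lborel \<Otimes>\<^sub>M \<rho>) ({-R..R} \<times> UNIV) < \<infinity>" .
    show "AE z in lborel \<Otimes>\<^sub>M \<rho>. z \<in> {-R..R} \<times> UNIV \<longrightarrow> norm (H z) \<le> B" using B by simp
    show "AE z in lborel \<Otimes>\<^sub>M \<rho>. z \<notin> {-R..R} \<times> UNIV \<longrightarrow> H z = 0"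
    proof (intro AE_I2 impI)
      fix z assume "z \<notin> {-R..R} \<times> (UNIV :: real set)"
      then have "z \<notin> K" using R[of "fst z"] by (cases z) (force simp: abs_le_iff)
      then show "H z = 0" by (rule K(2))
    qed
  qed
qed

lemma pair_sigma_finite_lborel:
  "finite_measure \<rho> \<Longrightarrow> pair_sigma_finite (lborel :: real measure) \<rho>"
  by (intro pair_sigma_finite.intro sigma_finite_lborel finite_measure.axioms)

lemma test_function_partial:
  fixes \<phi> :: "real \<times> real \<Rightarrow> real" and v :: "real \<times> real"
  assumes "\<phi> \<in> test_functions \<Omega>"
  defines "D \<equiv> \<lambda>z. frechet_derivative \<phi> (at z) v"
  shows "continuous_on UNIV D"
    and "z \<notin> closure {z. \<phi> z \<noteq> 0} \<Longrightarrow> D z = 0"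
    and "\<phi> differentiable (at z)"
proof -
  have "Ck_on 1 UNIV \<phi>" using assms(1) by (auto simp: test_functions_def)
  then show "continuous_on UNIV D" and diff: "\<phi> differentiable (at z)"
    by (simp_all add: D_def del: split_paired_All)
  assume z: "z \<notin> closure {z. \<phi> z \<noteq> 0}"
  have "((\<lambda>_. 0) has_derivative (\<lambda>_. 0)) (at z)" by simp
  then have "(\<phi> has_derivative (\<lambda>_. 0)) (at z)"
    by (rule has_derivative_transform_within_open[of _ _ _ _ "- closure {z. \<phi> z \<noteq> 0}"])
       (use z closure_subset[of "{z. \<phi> z \<noteq> 0}"] in auto)
  then show "D z = 0" by (simp add: D_def frechet_derivative_at[symmetric])
qed

lemma has_real_derivative_slice:
  fixes \<phi> :: "real \<times> real \<Rightarrow> real"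
  assumes "\<phi> differentiable (at (t, x))"
  shows "((\<lambda>s. \<phi> (s, x)) has_real_derivative frechet_derivative \<phi> (at (t, x)) (1, 0)) (at t)"
    and "((\<lambda>y. \<phi> (t, y)) has_real_derivative frechet_derivative \<phi> (at (t, x)) (0, 1)) (at x)"
proof -
  have D: "(\<phi> has_derivative frechet_derivative \<phi> (at (t, x))) (at (t, x))"
    using assms frechet_derivative_works by blast
  note scale = linear_cmul[OF has_derivative_linear[OF D]]
  have "((\<lambda>s. (s, x)) has_derivative (\<lambda>s. (s, 0))) (at t)"
    by (intro has_derivative_Pair has_derivative_ident has_derivative_const)
  from has_derivative_compose[OF this D]
  have 1: "((\<lambda>s. \<phi> (s, x)) has_derivative (\<lambda>s. frechet_derivative \<phi> (at (t, x)) (s, 0))) (at t)" .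
  have "frechet_derivative \<phi> (at (t, x)) (s, 0) = frechet_derivative \<phi> (at (t, x)) (1, 0) * s" for s
    using scale[of s "(1, 0)"] by (simp only: scaleR_Pair) (simp add: mult.commute)
  then show "((\<lambda>s. \<phi> (s, x)) has_real_derivative frechet_derivative \<phi> (at (t, x)) (1, 0)) (at t)"
    unfolding has_field_derivative_def by (intro has_derivative_eq_rhs[OF 1] ext)
  have "((\<lambda>y. (t, y)) has_derivative (\<lambda>y. (0, y))) (at x)"
    by (intro has_derivative_Pair has_derivative_ident has_derivative_const)
  from has_derivative_compose[OF this D]
  have 2: "((\<lambda>y. \<phi> (t, y)) has_derivative (\<lambda>y. frechet_derivative \<phi> (at (t, x)) (0, y))) (at x)" .
  have "frechet_derivative \<phi> (at (t, x)) (0, y) = frechet_derivative \<phi> (at (t, x)) (0, 1) * y" for y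
    using scale[of y "(0, 1)"] by (simp only: scaleR_Pair) (simp add: mult.commute)
  then show "((\<lambda>y. \<phi> (t, y)) has_real_derivative frechet_derivative \<phi> (at (t, x)) (0, 1)) (at x)"
    unfolding has_field_derivative_def by (intro has_derivative_eq_rhs[OF 2] ext)
qed

text \<open>
  The diagonal coupling has no transport cost.
\<close>

lemma wasserstein2_refl:
  assumes "sets \<rho> = sets borel"
  shows "wasserstein2 \<rho> \<rho> = 0"
proof -
  let ?\<gamma> = "distr \<rho> borel (\<lambda>x. (x, x))"
  note [measurable_cong] = assms
  have meas: "(\<lambda>x::real. (x, x)) \<in> \<rho> \<rightarrow>\<^sub>M borel"
    by (intro borel_measurable_continuous_onI[THEN measurable_cong_sets[OF assms refl, THEN equalityD2, THEN subsetD]] continuous_intros)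
  have "distr ?\<gamma> borel fst = \<rho>" "distr ?\<gamma> borel snd = \<rho>"
    using distr_distr[OF _ meas, of fst borel] distr_distr[OF _ meas, of snd borel]
    by (simp_all add: comp_def distr_id2[OF assms[symmetric]] borel_measurable_continuous_onI
        continuous_on_fst continuous_on_snd continuous_on_id)
  then have "?\<gamma> \<in> couplings \<rho> \<rho>" by (simp add: couplings_def)
  moreover have "(\<integral>\<^sup>+z. ennreal ((dist (fst z) (snd z))\<^sup>2) \<partial>?\<gamma>) = 0"
    using meas by (subst nn_integral_distr) (auto intro!: borel_measurable_continuous_onI continuous_intros)
  ultimately have "(INF \<gamma>\<in>couplings \<rho> \<rho>. \<integral>\<^sup>+z. ennreal ((dist (fst z) (snd z))\<^sup>2) \<partial>\<gamma>) \<le> 0"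
    by (intro INF_lower2) auto
  then show ?thesis by (simp add: wasserstein2_def)
qed

section \<open>Stationary solutions\<close>

context stationary_setting
begin

text \<open>
  Test with the product of a fixed nonnegative function \<open>\<eta>\<close> of time, with nonzero integral, and a
  balanced primitive \<open>\<psi>\<close> of space. The term with the time derivative disappears, because the integral
  of \<open>\<eta>'\<close> is zero and \<open>\<rho>\<close> does not depend on time; the other terms are the integral of \<open>\<eta>\<close> times the
  spatial identity.
\<close>

lemma solution_balanced_identity:
  assumes sol: "stationary_wasserstein_solution \<beta> V m \<rho>" and "a \<le> b" "0 < e"
    and g_loc: "locally_integrable g"
  shows "(\<integral>x. (plateau a b e x - (b - a) * plateau 0 1 e x) * V' x \<partial>\<rho>)
       + (\<integral>x. (plateau a b e x - (b - a) * plateau 0 1 e x) * g x \<partial>lborel) = 0"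
proof -
  define \<eta> where "\<eta> = plateau 1 2 1"
  define \<eta>' where "\<eta>' = (\<lambda>t. (bump ((t - 1) / 1) - bump ((t - 2) / 1)) / (1 * primitive bump 1))"
  define \<psi> where "\<psi> = balanced_primitive a b e"
  define \<psi>' where "\<psi>' = (\<lambda>x. plateau a b e x - (b - a) * plateau 0 1 e x)"
  have \<eta>: "(\<eta> has_real_derivative \<eta>' t) (at t)" for t
    unfolding \<eta>_def \<eta>'_def by (rule plateau_has_derivative) simp
  have \<psi>: "(\<psi> has_real_derivative \<psi>' x) (at x)" for x
    unfolding \<psi>_def \<psi>'_def by (rule balanced_primitive_has_derivative[OF \<open>0 < e\<close>])
  have \<eta>_out: "\<eta> t = 0" "\<eta>' t = 0" if "t \<notin> {1..3}" for t
    using that plateau_outside[of 1 2 1 t] bump_outside[of "t - 1"] bump_outside[of "t - 2"]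
    by (auto simp: \<eta>_def \<eta>'_def)
  let ?p = "min a 0" and ?q = "max b 1 + e"
  have \<psi>_out: "\<psi> x = 0" "\<psi>' x = 0" if "x \<notin> {?p..?q}" for x
  proof -
    have "x \<notin> {a..b + e}" "x \<notin> {0..1 + e}" using that by (auto simp: min_def max_def split: if_splits)
    then show "\<psi> x = 0" "\<psi>' x = 0"
      using balanced_primitive_outside[OF \<open>a \<le> b\<close> \<open>0 < e\<close> that] \<open>a \<le> b\<close> \<open>0 < e\<close>
      by (simp_all add: \<psi>_def \<psi>'_def plateau_outside)
  qed
  have cont_\<psi>: "continuous_on UNIV \<psi>"
    by (intro continuous_at_imp_continuous_on ballI DERIV_isCont[OF \<psi>])
  have cont_\<psi>': "continuous_on UNIV \<psi>'"
    unfolding \<psi>'_def by (intro continuous_intros continuous_plateau)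
  have cont_\<eta>': "continuous_on UNIV \<eta>'"
    unfolding \<eta>'_def by (intro continuous_intros continuous_on_compose2[OF continuous_bump[of UNIV]])
      (use primitive_bump_1_pos in auto)
  define \<phi> where "\<phi> = (\<lambda>z. \<eta> (fst z) * \<psi> (snd z))"
  have "\<phi> \<in> test_functions ({0<..} \<times> UNIV)"
  proof (rule test_functionI[of _ "{1..3} \<times> {?p..?q}"])
    show "\<phi> \<in> fun_algebra smooth_generators"
      unfolding \<phi>_def \<eta>_def \<psi>_def
      by (intro fun_algebra.mult plateau_smooth balanced_primitive_smooth bounded_linear_fst bounded_linear_snd)
    show "compact ({1..3::real} \<times> {?p..?q})" by (intro compact_Times) auto
    show "\<phi> z = 0" if "z \<notin> {1..3} \<times> {?p..?q}" for z
      using that \<eta>_out \<psi>_out by (cases z) (auto simp: \<phi>_def)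
  qed auto
  then have eq: "(LINT t:{0<..}|lborel.
           (\<integral>x. - deriv (\<lambda>s. \<phi> (s, x)) t + deriv (\<lambda>y. \<phi> (t, y)) x * V' x \<partial>\<rho>))
        + (LINT t:{0<..}|lborel. (\<integral>x. deriv (\<lambda>y. \<phi> (t, y)) x * g x \<partial>lborel)) = 0"
    using sol by (auto simp: stationary_wasserstein_solution_def wasserstein_solution_def)
  have d1: "deriv (\<lambda>s. \<phi> (s, x)) t = \<eta>' t * \<psi> x" for t x
    unfolding \<phi>_def fst_conv snd_conv by (intro DERIV_imp_deriv DERIV_cmult_right \<eta>)
  have d2: "deriv (\<lambda>y. \<phi> (t, y)) x = \<eta> t * \<psi>' x" for t x
    unfolding \<phi>_def fst_conv snd_conv by (intro DERIV_imp_deriv DERIV_cmult \<psi>)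
  define P where "P = (\<integral>x. \<psi> x \<partial>\<rho>)"
  define B where "B = (\<integral>x. \<psi>' x * V' x \<partial>\<rho>)"
  define C where "C = (\<integral>x. \<psi>' x * g x \<partial>lborel)"
  have int: "integrable \<rho> \<psi>" "integrable \<rho> (\<lambda>x. \<psi>' x * V' x)"
    by (rule integrable_finite_continuous_compact_support[OF finite_\<rho> sets_\<rho>, of _ ?p ?q];
        auto intro!: cont_\<psi> cont_\<psi>' V'_cont continuous_on_mult \<psi>_out)+
  have i1: "(\<integral>x. - deriv (\<lambda>s. \<phi> (s, x)) t + deriv (\<lambda>y. \<phi> (t, y)) x * V' x \<partial>\<rho>) = - \<eta>' t * P + \<eta> t * B" for t
  proof -
    have "(\<integral>x. - \<eta>' t * \<psi> x + \<eta> t * (\<psi>' x * V' x) \<partial>\<rho>) = - \<eta>' t * P + \<eta> t * B"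
      using int by (subst Bochner_Integration.integral_add) (auto simp: P_def B_def)
    then show ?thesis unfolding d1 d2 by (simp add: mult.assoc)
  qed
  have i2: "(\<integral>x. deriv (\<lambda>y. \<phi> (t, y)) x * g x \<partial>lborel) = \<eta> t * C" for t
    unfolding d2 C_def by (simp add: mult.assoc)
  have ind: "indicator {0<..} t *\<^sub>R h t = h t" if "\<And>t. t \<notin> {1..3} \<Longrightarrow> h t = 0" for h :: "real \<Rightarrow> real" and t
    using that[of t] by (cases "t \<in> {1..3}") auto
  have \<eta>_int: "integrable lborel \<eta>" "integrable lborel \<eta>'"
    using cont_\<eta>' \<eta>_out continuous_plateau[of UNIV 1 2 1]
    by (auto intro!: integrable_continuous_compact_support[of _ 1 3] simp: \<eta>_def)
  have \<eta>'_0: "(\<integral>t. \<eta>' t \<partial>lborel) = 0"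
    by (rule integral_derivative_compact_support[OF \<eta> cont_\<eta>', of 1 3]) (use \<eta>_out in auto)
  have "(LINT t:{0<..}|lborel. - \<eta>' t * P + \<eta> t * B) = (\<integral>t. - \<eta>' t * P + \<eta> t * B \<partial>lborel)"
    unfolding set_lebesgue_integral_def using \<eta>_out by (subst ind) auto
  also have "\<dots> = (\<integral>t. - \<eta>' t * P \<partial>lborel) + (\<integral>t. \<eta> t * B \<partial>lborel)"
    using \<eta>_int by (intro Bochner_Integration.integral_add) auto
  also have "\<dots> = (\<integral>t. \<eta> t \<partial>lborel) * B"
    using \<eta>'_0 by simp
  finally have I1: "(LINT t:{0<..}|lborel. - \<eta>' t * P + \<eta> t * B) = (\<integral>t. \<eta> t \<partial>lborel) * B" .
  have I2: "(LINT t:{0<..}|lborel. \<eta> t * C) = (\<integral>t. \<eta> t \<partial>lborel) * C"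
    unfolding set_lebesgue_integral_def using \<eta>_out by (subst ind) auto
  have "(\<integral>t. \<eta> t \<partial>lborel) * (B + C) = 0"
    using eq unfolding i1 i2 I1 I2 by (simp add: distrib_left)
  then have "B + C = 0" using integral_plateau_pos by (auto simp: \<eta>_def)
  then show ?thesis by (simp add: B_def C_def \<psi>'_def)
qed

lemma solution_imp_zero_dissipation:
  assumes sol: "stationary_wasserstein_solution \<beta> V m \<rho>"
  shows "\<rho> \<in> M_plus_c \<and> dissipation \<beta> V \<rho> = 0"
proof -
  have "AE t in lborel. 0 < (t::real) \<longrightarrow> \<rho> \<in> M_plus_c"
    and fin_int: "(\<integral>\<^sup>+t\<in>{1..2}. dissipation \<beta> V \<rho> \<partial>(lborel :: real measure)) < \<infinity>"
    using sol by (auto simp: stationary_wasserstein_solution_def wasserstein_solution_def)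
  have M: "\<rho> \<in> M_plus_c"
  proof (rule ccontr)
    assume "\<rho> \<notin> M_plus_c"
    with \<open>AE t in lborel. 0 < t \<longrightarrow> \<rho> \<in> M_plus_c\<close> have "AE t in lborel. t \<notin> {0<..(1::real)}"
      by (rule_tac AE_mp) auto
    then have "emeasure lborel {0<..(1::real)} = 0"
      by (subst (asm) AE_iff_measurable[where N = "{0<..1}"]) auto
    then show False by simp
  qed
  have fin: "dissipation \<beta> V \<rho> < \<infinity>"
    using fin_int by (auto simp: nn_integral_cmult_indicator less_top)
  then have W: "beta_density \<beta> \<rho> \<in> W11_loc"
    by (auto simp: dissipation_def split: if_splits)
  interpret regular_setting \<beta> V m \<rho> by unfold_locales (fact M W)+
  obtain c where c: "AE x in lborel. r x * V' x + g x = c" "AE x in singular_part \<rho>. V' x = 0"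
    using flux_constant[OF solution_balanced_identity[OF sol _ _ g_locally_integrable]] by blast
  have "c = 0" by (rule flux_zero[OF c(1) fin])
  then have "AE x in lborel. g x = - (r x * V' x)"
    using c(1) by (auto elim!: AE_mp)
  then show ?thesis using M c(2) dissipation_eq_0_iff by blast
qed

text \<open>
  For each fixed time, the relations \<open>g = - r V'\<close> almost everywhere and \<open>V' = 0\<close> on the singular part make
  the two spatial terms of the weak formulation cancel. The time derivative integrates to zero by
  Fubini's theorem.
\<close>

lemma zero_dissipation_imp_solution:
  assumes M: "\<rho> \<in> M_plus_c" and zero: "dissipation \<beta> V \<rho> = 0"
  shows "stationary_wasserstein_solution \<beta> V m \<rho>"
proof -
  have W: "beta_density \<beta> \<rho> \<in> W11_loc"
    using zero by (auto simp: dissipation_def split: if_splits)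
  interpret regular_setting \<beta> V m \<rho> by unfold_locales (fact M W)+
  interpret pair: pair_sigma_finite "lborel :: real measure" \<rho>
    by (rule pair_sigma_finite_lborel[OF finite_\<rho>])
  have flux: "AE x in lborel. g x = - (r x * V' x)" and sing: "AE x in singular_part \<rho>. V' x = 0"
    using zero dissipation_eq_0_iff by auto
  have weak: "(LINT t:{0<..}|lborel.
           (\<integral>x. - deriv (\<lambda>s. \<phi> (s, x)) t + deriv (\<lambda>y. \<phi> (t, y)) x * V' x \<partial>\<rho>))
        + (LINT t:{0<..}|lborel. (\<integral>x. deriv (\<lambda>y. \<phi> (t, y)) x * g x \<partial>lborel)) = 0"
    if \<phi>: "\<phi> \<in> test_functions ({0<..} \<times> UNIV)" for \<phi>
  proof -
    define K where "K = closure {z. \<phi> z \<noteq> 0}"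
    have K: "compact K" "K \<subseteq> {0<..} \<times> UNIV" using \<phi> by (auto simp: test_functions_def K_def)
    define \<phi>t where "\<phi>t z = frechet_derivative \<phi> (at z) (1, 0)" for z
    define \<phi>x where "\<phi>x z = frechet_derivative \<phi> (at z) (0, 1)" for z
    note diff = test_function_partial(3)[OF \<phi>]
    have dt: "deriv (\<lambda>s. \<phi> (s, x)) t = \<phi>t (t, x)" and dx: "deriv (\<lambda>y. \<phi> (t, y)) x = \<phi>x (t, x)" for t x
      unfolding \<phi>t_def \<phi>x_def by (intro DERIV_imp_deriv has_real_derivative_slice diff)+
    have ct: "continuous_on UNIV \<phi>t" and cx: "continuous_on UNIV \<phi>x"
      unfolding \<phi>t_def \<phi>x_def by (rule test_function_partial(1)[OF \<phi>])+
    have outt: "\<phi>t z = 0" and outx: "\<phi>x z = 0" if "z \<notin> K" for z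
      unfolding \<phi>t_def \<phi>x_def by (rule test_function_partial(2)[OF \<phi> that[unfolded K_def]])+
    have "bounded (fst ` K)" "bounded (snd ` K)"
      using K(1) by (auto intro!: compact_imp_bounded compact_continuous_image continuous_intros)
    then obtain R S where R: "\<And>z. z \<in> K \<Longrightarrow> \<bar>fst z\<bar> \<le> R" and S: "\<And>z. z \<in> K \<Longrightarrow> \<bar>snd z\<bar> \<le> S"
      by (fastforce simp: bounded_iff)
    have notK: "(t, x) \<notin> K" if "t \<notin> {-R..R} \<or> x \<notin> {-S..S}" for t x
      using that R[of "(t, x)"] S[of "(t, x)"] by (auto simp: abs_le_iff)
    have slice: "continuous_on UNIV (\<lambda>x. H (t, x))" "continuous_on UNIV (\<lambda>s. H (s, x))"
      if "continuous_on UNIV H" for H :: "real \<times> real \<Rightarrow> real" and t x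
      by (rule continuous_on_compose2[OF that]; auto intro!: continuous_intros)+
    define H where "H z = \<phi>x z * V' (snd z)" for z
    have cH: "continuous_on UNIV H"
      unfolding H_def by (intro continuous_intros cx continuous_on_compose2[OF V'_cont]) auto
    have outH: "H z = 0" if "z \<notin> K" for z using outx[OF that] by (simp add: H_def)
    define A where "A t = (\<integral>x. \<phi>t (t, x) \<partial>\<rho>)" for t
    define B where "B t = (\<integral>x. H (t, x) \<partial>\<rho>)" for t
    have intt: "integrable (lborel \<Otimes>\<^sub>M \<rho>) \<phi>t" and intH: "integrable (lborel \<Otimes>\<^sub>M \<rho>) H"
      by (rule integrable_pair_continuous_compact_support[OF finite_\<rho> sets_\<rho>]; fact ct cH K(1) outt outH)+
    have A_int: "integrable lborel A" and B_int: "integrable lborel B"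
      unfolding A_def B_def by (intro pair.integrable_fst' intt intH)+
    have xint: "integrable \<rho> (\<lambda>x. G (t, x))"
      if "continuous_on UNIV G" "\<And>z. z \<notin> K \<Longrightarrow> G z = 0" for G :: "real \<times> real \<Rightarrow> real" and t
      by (rule integrable_finite_continuous_compact_support[OF finite_\<rho> sets_\<rho> slice(1)[OF that(1)], of "-S" S])
         (use that(2) notK in auto)
    have i1: "(\<integral>x. - deriv (\<lambda>s. \<phi> (s, x)) t + deriv (\<lambda>y. \<phi> (t, y)) x * V' x \<partial>\<rho>) = - A t + B t" for t
    proof -
      have "(\<integral>x. - \<phi>t (t, x) + H (t, x) \<partial>\<rho>) = - A t + B t"
        unfolding A_def B_def using xint[OF ct outt] xint[OF cH outH]
        by (subst Bochner_Integration.integral_add) auto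
      then show ?thesis unfolding dt dx by (simp add: H_def)
    qed
    have i2: "(\<integral>x. deriv (\<lambda>y. \<phi> (t, y)) x * g x \<partial>lborel) = - B t" for t
    proof -
      have "B t = (\<integral>x. r x * H (t, x) \<partial>lborel) + (\<integral>x. H (t, x) \<partial>singular_part \<rho>)"
        unfolding B_def
        by (rule integral_lebesgue_decomposition[OF sets_\<rho> decomposition u_finite xint[OF cH outH]])
      moreover have "(\<integral>x. H (t, x) \<partial>singular_part \<rho>) = 0"
        by (rule integral_eq_zero_AE) (use sing in eventually_elim, simp add: H_def)
      moreover have "(\<integral>x. \<phi>x (t, x) * g x \<partial>lborel) = (\<integral>x. - (r x * H (t, x)) \<partial>lborel)"
      proof (rule integral_cong_AE)
        have [measurable]: "(\<lambda>x. \<phi>x (t, x)) \<in> borel_measurable borel" "(\<lambda>x. H (t, x)) \<in> borel_measurable borel"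
          "g \<in> borel_measurable borel" "u \<in> borel_measurable borel"
          by (intro borel_measurable_continuous_onI slice cx cH g_measurable u_measurable)+
        show "(\<lambda>x. \<phi>x (t, x) * g x) \<in> borel_measurable lborel"
          "(\<lambda>x. - (r x * H (t, x))) \<in> borel_measurable lborel" by measurable
        show "AE x in lborel. \<phi>x (t, x) * g x = - (r x * H (t, x))"
          using flux by eventually_elim (simp add: H_def)
      qed
      ultimately show ?thesis unfolding dx by simp
    qed
    have A_total: "(\<integral>t. A t \<partial>lborel) = 0"
    proof -
      have "(\<integral>t. A t \<partial>lborel) = (\<integral>x. (\<integral>t. \<phi>t (t, x) \<partial>lborel) \<partial>\<rho>)"
        unfolding A_def by (rule pair.Fubini_integral[symmetric]) (simp add: intt)
      moreover have "(\<integral>t. \<phi>t (t, x) \<partial>lborel) = 0" for x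
      proof (rule integral_derivative_compact_support[of "\<lambda>s. \<phi> (s, x)" _ "-R" R])
        show "((\<lambda>s. \<phi> (s, x)) has_real_derivative \<phi>t (t, x)) (at t)" for t
          unfolding \<phi>t_def by (rule has_real_derivative_slice(1)[OF diff])
        show "continuous_on UNIV (\<lambda>t. \<phi>t (t, x))" by (rule slice(2)[OF ct])
        show "\<phi> (t, x) = 0" if "t \<notin> {-R..R}" for t
          using notK[of t x] that closure_subset[of "{z. \<phi> z \<noteq> 0}"] by (auto simp: K_def)
        show "\<phi>t (t, x) = 0" if "t \<notin> {-R..R}" for t using notK[of t x] that outt by auto
      qed
      ultimately show ?thesis by simp
    qed
    have A_pos: "indicator {0<..} t *\<^sub>R A t = A t" for t
    proof (cases "0 < t")
      case False
      then have "\<phi>t (t, x) = 0" for x using K(2) by (intro outt) auto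
      then show ?thesis by (simp add: A_def)
    qed simp
    have setint: "set_integrable lborel {0<..} (\<lambda>t. - A t)" "set_integrable lborel {0<..} B"
      unfolding set_integrable_def
      by (intro integrable_mult_indicator integrable_minus A_int B_int; simp)+
    have "(LINT t:{0<..}|lborel. - A t + B t) = (LINT t:{0<..}|lborel. - A t) + (LINT t:{0<..}|lborel. B t)"
      by (rule set_integral_add(2)[OF setint])
    moreover have "(LINT t:{0<..}|lborel. A t) = 0"
      unfolding set_lebesgue_integral_def A_pos by (rule A_total)
    then have "(LINT t:{0<..}|lborel. - A t) = 0"
      by (simp add: set_lebesgue_integral_def)
    moreover have "(LINT t:{0<..}|lborel. - B t) = - (LINT t:{0<..}|lborel. B t)"
      by (simp add: set_lebesgue_integral_def)
    ultimately show ?thesis unfolding i1 i2 by simp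
  qed
  show ?thesis
    unfolding stationary_wasserstein_solution_def wasserstein_solution_def
  proof (intro conjI)
    show "wasserstein_continuous_curve m (\<lambda>t. \<rho>)"
      using \<rho>_M2 by (simp add: wasserstein_continuous_curve_def wasserstein2_refl[OF sets_\<rho>])
  qed (use M zero weak in auto)
qed

end

theorem theorem2p14:
  fixes \<beta> V :: "real \<Rightarrow> real" and lam m :: real and \<rho> :: "real measure"
  assumes "Ck_on 1 {0..} \<beta>"
    and "mono_on {0..} \<beta>"
    and "\<beta> 0 = 0"
    and "\<exists>l. (\<beta> \<longlongrightarrow> l) at_top"
    and "Ck_on 2 UNIV V"
    and "\<And>x. deriv (deriv V) x \<ge> lam"
    and "Liminf at_infinity (\<lambda>x. ereal (V x / \<bar>x\<bar>\<^sup>2)) \<ge> 0"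
    and "m > 0"
    and "\<rho> \<in> M2 m"
  shows "stationary_wasserstein_solution \<beta> V m \<rho> \<longleftrightarrow>
           \<rho> \<in> M2c m \<and> dissipation \<beta> V \<rho> = 0"
proof -
  have "continuous_on {0..} \<beta>"
    using assms(1) by (auto simp: continuous_on_eq_continuous_within intro: differentiable_imp_continuous_within)
  then interpret stationary_setting \<beta> V m \<rho>
    using assms continuous_deriv_of_Ck_on[OF assms(5)] by unfold_locales auto
  show ?thesis
    using solution_imp_zero_dissipation zero_dissipation_imp_solution assms(9)
    by (auto simp: M2c_def)
qed

end
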